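(* Let $m,n$ be positive integers, $K=J(2m,2n)$, $\xi=e^{2\pi\sqrt{-1}/(4mn-1)}$, and for $1\le i\le 2mn-1$ let $\rho_i\colon\pi_1(E_K)\to\mathrm{SL}_2(\mathbb{C})$ be the irreducible metabelian representation given by \[ \rho_i(x_1)=\begin{bmatrix}\xi^i&0\\0&\xi^{-i}\end{bmatrix},\quad \rho_i(x_2)=\begin{bmatrix}\xi^{2mi}&0\\0&\xi^{-2mi}\end{bmatrix},\quad \rho_i(\mu)=\begin{bmatrix}0&1\\-1&0\end{bmatrix}. \] Set $q_i=\frac{4mn-1}{\gcd(4mn-1,i)}$ and $(\rho_i)_{2N}=\sigma_{2N}\circ\rho_i$. Then \[ \lim_{N\to\infty}\frac{\log|\mathbb{T}_{J(2m,2n),(\rho_i)_{2N}}|}{2N}=\frac{1}{q_i}\log\frac{2mn-1}{2}+\frac12\log2=\frac{\gcd(4mn-1,i)}{4mn-1}\log\frac{2mn-1}{2}+\frac12\log2 . \] In particular, the growth order of $\log|\mathbb{T}_{J(2m,2n),(\rho_i)_{2N}}|$ is the same as $2N$ (in the sense that its quotient by $2N$ converges to a finite limit).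
   Context: $J(2m,2n)$ is the double twist knot (a genus one two-bridge knot) in Hoste--Shanahan's notation. Its exterior $E_K=S^3\setminus N(K)$ has fundamental group with the Lin presentation (associated with a genus one free Seifert surface) \[ \pi_1(E_K)=\langle x_1,x_2,\mu\mid \mu x_1^m\mu^{-1}=x_1^mx_2^{-1},\ \mu x_2^{-n}x_1\mu^{-1}=x_2^{-n}\rangle, \] where $\mu$ is a meridian. The $\rho_i$, $1\le i\le 2mn-1$, represent all irreducible metabelian $\mathrm{SL}_2(\mathbb{C})$-representations of $\pi_1(E_K)$ up to conjugation (metabelian: the commutator subgroup has abelian image). $\sigma_n\colon\mathrm{SL}_2(\mathbb{C})\to\mathrm{SL}_n(\mathbb{C})$ is the $n$-dimensional irreducible representation, given by the action on the space of homogeneous polynomials $p(x,y)$ of degree $n-1$: $A\cdot p(x,y)=p(x',y')$ with $\binom{x'}{y'}=A^{-1}\binom{x}{y}$. Reidemeister torsion: for $\varphi\colon\pi_1(E_K)\to\mathrm{SL}_d(\mathbb{C})$ with linear extension $\widetilde\varphi$ to $\mathbb{Z}[\pi_1(E_K)]$, and $r_1=\mu x_1^m\mu^{-1}x_2x_1^{-m}$, $r_2=\mu x_2^{-n}x_1\mu^{-1}x_2^{n}$, the torsion is, up to sign, \[ \mathbb{T}_{K,\varphi}=\frac{\det\big(\widetilde\varphi(\partial r_k/\partial x_l)\big)_{1\le k,l\le2}}{\det\widetilde\varphi(\mu-1)}, \] defined when numerator and denominator are both nonzero (acyclicity of the twisted chain complex); $\partial r_k/\partial x_l$ are Fox derivatives.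 *)

theory Defs
  imports
    Complex_Main
    "HOL-Library.Poly_Mapping"
    "HOL-Algebra.Generated_Groups"
    "Jordan_Normal_Form.Determinant"
begin

section \<open>Groups given by generators and relators\<close>

text \<open>A letter \<open>(x, False)\<close> stands for the generator \<open>x\<close>, and \<open>(x, True)\<close> for its inverse.\<close>

type_synonym 'a word = "('a \<times> bool) list"

definition gen :: "'a \<Rightarrow> 'a word" where
  "gen x = [(x, False)]"

definition gen_inv :: "'a \<Rightarrow> 'a word" where
  "gen_inv x = [(x, True)]"

definition word_pow :: "'a word \<Rightarrow> nat \<Rightarrow> 'a word" where
  "word_pow w k = concat (replicate k w)"

inductive pres_eq :: "'a word set \<Rightarrow> 'a word \<Rightarrow> 'a word \<Rightarrow> bool" for R where
  refl: "pres_eq R u u"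
| sym: "pres_eq R u v \<Longrightarrow> pres_eq R v u"
| trans: "pres_eq R u v \<Longrightarrow> pres_eq R v w \<Longrightarrow> pres_eq R u w"
| cancel: "pres_eq R (u @ [(x, s), (x, \<not> s)] @ v) (u @ v)"
| relator: "r \<in> R \<Longrightarrow> pres_eq R (u @ r @ v) (u @ v)"

definition word_class :: "'a word set \<Rightarrow> 'a word \<Rightarrow> 'a word set" where
  "word_class R u = {v. pres_eq R u v}"

definition pres_group :: "'a word set \<Rightarrow> 'a word set monoid" where
  "pres_group R =
    \<lparr>carrier = range (word_class R),
     monoid.mult = (\<lambda>A B. {w. \<exists>u\<in>A. \<exists>v\<in>B. pres_eq R (u @ v) w}),
     one = word_class R []\<rparr>"

abbreviation free_group :: "'a word set monoid" where
  "free_group \<equiv> pres_group {}"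

text \<open>The canonical projection from the free group onto \<open>pres_group R\<close>.\<close>

definition pres_proj :: "'a word set \<Rightarrow> 'a word set \<Rightarrow> 'a word set" where
  "pres_proj R A = {w. \<exists>u\<in>A. pres_eq R u w}"


section \<open>Integral group rings and Fox derivatives\<close>

text \<open>Elements of the integral group ring of \<open>G\<close> are finitely supported functions
  \<open>'g \<Rightarrow>\<^sub>0 int\<close> on the elements of \<open>G\<close>.\<close>

definition gr_lmult :: "('g, 'c) monoid_scheme \<Rightarrow> 'g \<Rightarrow> ('g \<Rightarrow>\<^sub>0 int) \<Rightarrow> ('g \<Rightarrow>\<^sub>0 int)" where
  "gr_lmult G g a =
    (\<Sum>h\<in>Poly_Mapping.keys a. Poly_Mapping.single (g \<otimes>\<^bsub>G\<^esub> h) (Poly_Mapping.lookup a h))"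

definition gr_map :: "('g \<Rightarrow> 'h) \<Rightarrow> ('g \<Rightarrow>\<^sub>0 int) \<Rightarrow> ('h \<Rightarrow>\<^sub>0 int)" where
  "gr_map f a =
    (\<Sum>g\<in>Poly_Mapping.keys a. Poly_Mapping.single (f g) (Poly_Mapping.lookup a g))"

definition gr_lin_ext :: "nat \<Rightarrow> ('g \<Rightarrow> complex mat) \<Rightarrow> ('g \<Rightarrow>\<^sub>0 int) \<Rightarrow> complex mat" where
  "gr_lin_ext d \<phi> a =
    mat d d (\<lambda>(i, j). \<Sum>g\<in>Poly_Mapping.keys a. of_int (Poly_Mapping.lookup a g) * \<phi> g $$ (i, j))"

text \<open>The Fox derivative with respect to the generator \<open>x\<close>, with values in the integral group
  ring of the free group; it is determined by \<open>D(uv) = D(u) + u D(v)\<close>, \<open>D(x) = 1\<close> and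
  \<open>D(y) = 0\<close> for generators \<open>y \<noteq> x\<close>, whence \<open>D(x\<inverse>) = - x\<inverse>\<close>.\<close>

fun fox :: "'a \<Rightarrow> 'a word \<Rightarrow> ('a word set \<Rightarrow>\<^sub>0 int)" where
  "fox x [] = 0"
| "fox x ((y, False) # w) =
    (if y = x then Poly_Mapping.single \<one>\<^bsub>free_group\<^esub> 1 else 0)
    + gr_lmult free_group (word_class {} (gen y)) (fox x w)"
| "fox x ((y, True) # w) =
    - (if y = x then Poly_Mapping.single (word_class {} (gen_inv y)) 1 else 0)
    + gr_lmult free_group (word_class {} (gen_inv y)) (fox x w)"


section \<open>Matrix representations\<close>

definition SL :: "nat \<Rightarrow> complex mat monoid" where
  "SL d = \<lparr>carrier = {A \<in> carrier_mat d d. det A = 1}, monoid.mult = (*), one = 1\<^sub>m d\<rparr>"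

definition irreducible_rep :: "('g, 'c) monoid_scheme \<Rightarrow> nat \<Rightarrow> ('g \<Rightarrow> complex mat) \<Rightarrow> bool" where
  "irreducible_rep G d \<phi> \<longleftrightarrow> d > 0 \<and>
    (\<forall>W \<subseteq> carrier_vec d.
       0\<^sub>v d \<in> W \<and> (\<forall>v\<in>W. \<forall>w\<in>W. v + w \<in> W) \<and> (\<forall>c. \<forall>v\<in>W. c \<cdot>\<^sub>v v \<in> W) \<and>
       (\<forall>g\<in>carrier G. \<forall>v\<in>W. \<phi> g *\<^sub>v v \<in> W)
       \<longrightarrow> W = {0\<^sub>v d} \<or> W = carrier_vec d)"

definition metabelian_rep :: "('g, 'c) monoid_scheme \<Rightarrow> ('g \<Rightarrow> complex mat) \<Rightarrow> bool" where
  "metabelian_rep G \<phi> \<longleftrightarrow>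
    (\<forall>g \<in> derived G (carrier G). \<forall>h \<in> derived G (carrier G). \<phi> g * \<phi> h = \<phi> h * \<phi> g)"

text \<open>Polynomials in \<open>x, y\<close> are elements of \<^typ>\<open>complex poly poly\<close>: the outer variable is \<open>y\<close>
  and the coefficients are polynomials in \<open>x\<close>, so that \<open>monom (monom c i) j\<close> is \<open>c x^i y^j\<close>
  and \<open>[:[:0, a:], [:b:]:]\<close> is \<open>a x + b y\<close>.\<close>

definition poly2_subst ::
    "complex poly poly \<Rightarrow> complex poly poly \<Rightarrow> complex poly poly \<Rightarrow> complex poly poly" where
  "poly2_subst p x' y' =
    (\<Sum>j\<le>degree p. \<Sum>i\<le>degree (coeff p j). [:[:coeff (coeff p j) i:]:] * x' ^ i * y' ^ j)"

definition SL2_act :: "complex mat \<Rightarrow> complex poly poly \<Rightarrow> complex poly poly" where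
  "SL2_act A p =
    (let B = inv\<^bsub>SL 2\<^esub> A
     in poly2_subst p [:[:0, B $$ (0, 0):], [:B $$ (0, 1):]:] [:[:0, B $$ (1, 0):], [:B $$ (1, 1):]:])"

text \<open>The matrix of \<^const>\<open>SL2_act\<close> on the homogeneous polynomials of degree \<open>n - 1\<close> in the basis
  \<open>x^(n-1), x^(n-2) y, \<dots>, y^(n-1)\<close>.\<close>

definition sym_rep :: "nat \<Rightarrow> complex mat \<Rightarrow> complex mat" where
  "sym_rep n A =
    mat n n (\<lambda>(k, j). coeff (coeff (SL2_act A (monom (monom 1 (n - 1 - j)) j)) k) (n - 1 - k))"


section \<open>The group of the double twist knot and its torsion\<close>

datatype knot_gen = X1 | X2 | Mu

definition rel1 :: "nat \<Rightarrow> knot_gen word" where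
  "rel1 m = gen Mu @ word_pow (gen X1) m @ gen_inv Mu @ gen X2 @ word_pow (gen_inv X1) m"

definition rel2 :: "nat \<Rightarrow> knot_gen word" where
  "rel2 n = gen Mu @ word_pow (gen_inv X2) n @ gen X1 @ gen_inv Mu @ word_pow (gen X2) n"

text \<open>The fundamental group of the exterior of \<open>J(2m,2n)\<close>, by its Lin presentation.\<close>

abbreviation twist_rels :: "nat \<Rightarrow> nat \<Rightarrow> knot_gen word set" where
  "twist_rels m n \<equiv> {rel1 m, rel2 n}"

abbreviation twist_group :: "nat \<Rightarrow> nat \<Rightarrow> knot_gen word set monoid" where
  "twist_group m n \<equiv> pres_group (twist_rels m n)"

definition twist_elt :: "nat \<Rightarrow> nat \<Rightarrow> knot_gen \<Rightarrow> knot_gen word set" where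
  "twist_elt m n x = word_class (twist_rels m n) (gen x)"

definition fox_block ::
    "nat \<Rightarrow> nat \<Rightarrow> nat \<Rightarrow> (knot_gen word set \<Rightarrow> complex mat) \<Rightarrow> knot_gen word \<Rightarrow> knot_gen
      \<Rightarrow> complex mat" where
  "fox_block m n d \<phi> r x = gr_lin_ext d \<phi> (gr_map (pres_proj (twist_rels m n)) (fox x r))"

definition torsion_num :: "nat \<Rightarrow> nat \<Rightarrow> nat \<Rightarrow> (knot_gen word set \<Rightarrow> complex mat) \<Rightarrow> complex" where
  "torsion_num m n d \<phi> =
    det (four_block_mat (fox_block m n d \<phi> (rel1 m) X1) (fox_block m n d \<phi> (rel1 m) X2)
                        (fox_block m n d \<phi> (rel2 n) X1) (fox_block m n d \<phi> (rel2 n) X2))"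

definition torsion_den :: "nat \<Rightarrow> nat \<Rightarrow> nat \<Rightarrow> (knot_gen word set \<Rightarrow> complex mat) \<Rightarrow> complex" where
  "torsion_den m n d \<phi> =
    det (gr_lin_ext d \<phi> (Poly_Mapping.single (twist_elt m n Mu) 1
                         - Poly_Mapping.single \<one>\<^bsub>twist_group m n\<^esub> 1))"

definition torsion_defined :: "nat \<Rightarrow> nat \<Rightarrow> nat \<Rightarrow> (knot_gen word set \<Rightarrow> complex mat) \<Rightarrow> bool" where
  "torsion_defined m n d \<phi> \<longleftrightarrow> torsion_num m n d \<phi> \<noteq> 0 \<and> torsion_den m n d \<phi> \<noteq> 0"

text \<open>The torsion is only well defined up to sign; this is the representative given by the
  presentation, to be used under \<^const>\<open>torsion_defined\<close>.\<close>

definition torsion :: "nat \<Rightarrow> nat \<Rightarrow> nat \<Rightarrow> (knot_gen word set \<Rightarrow> complex mat) \<Rightarrow> complex" where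
  "torsion m n d \<phi> = torsion_num m n d \<phi> / torsion_den m n d \<phi>"


section \<open>Existence of the metabelian representations\<close>

text \<open>The presented groups are groups with the expected universal property, and the values
  prescribed on the generators do define an irreducible metabelian representation
  (\<open>twist_metabelian_rep_exists\<close>), so hypotheses asking for one are satisfiable.\<close>

lemma pres_eq_append: "pres_eq R u u' \<Longrightarrow> pres_eq R (a @ u @ b) (a @ u' @ b)"
proof (induction rule: pres_eq.induct)
  case (cancel u x s v)
  show ?case using pres_eq.cancel[of R "a @ u" x s "v @ b"] by simp
next
  case (relator r u v)
  show ?case using pres_eq.relator[OF relator, of "a @ u" "v @ b"] by simp
qed (auto intro: pres_eq.intros)

lemma pres_eq_append2:
  assumes "pres_eq R u u'" "pres_eq R v v'" shows "pres_eq R (u @ v) (u' @ v')"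
  using pres_eq_append[OF assms(1), of "[]" v] pres_eq_append[OF assms(2), of u' "[]"]
  by (auto intro: pres_eq.trans)

lemma word_class_eq_iff: "word_class R u = word_class R v \<longleftrightarrow> pres_eq R u v"
  unfolding word_class_def by (auto intro: pres_eq.intros)

lemma word_class_mult: "word_class R u \<otimes>\<^bsub>pres_group R\<^esub> word_class R v = word_class R (u @ v)"
  unfolding pres_group_def word_class_def
  by (auto intro: pres_eq.intros dest: pres_eq_append2 intro!: exI bexI)

lemma word_class_one: "\<one>\<^bsub>pres_group R\<^esub> = word_class R []"
  by (simp add: pres_group_def)

lemma pres_group_carrier: "carrier (pres_group R) = range (word_class R)"
  by (simp add: pres_group_def)

fun word_inv :: "'a word \<Rightarrow> 'a word" where
  "word_inv [] = []"
| "word_inv ((x, s) # w) = word_inv w @ [(x, \<not> s)]"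

lemma word_inv_left: "pres_eq R (word_inv w @ w) []"
proof (induction w rule: word_inv.induct)
  case (2 x s w)
  have "pres_eq R (word_inv w @ [(x, \<not> s), (x, \<not> \<not> s)] @ w) (word_inv w @ w)"
    by (rule pres_eq.cancel)
  then show ?case using 2 by (auto intro: pres_eq.trans)
qed (auto intro: pres_eq.intros)

lemma group_pres_group: "group (pres_group R)"
proof (rule groupI)
  fix x assume "x \<in> carrier (pres_group R)"
  then obtain w where "x = word_class R w" by (auto simp: pres_group_carrier)
  then show "\<exists>y\<in>carrier (pres_group R). y \<otimes>\<^bsub>pres_group R\<^esub> x = \<one>\<^bsub>pres_group R\<^esub>"
    using word_inv_left[of R w]
    by (auto simp: pres_group_carrier word_class_one word_class_mult word_class_eq_iff)
qed (auto simp: pres_group_carrier word_class_one word_class_mult)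

lemma group_SL: "group (SL d)"
proof (rule groupI)
  fix A assume A: "A \<in> carrier (SL d)"
  then have "adj_mat A \<in> carrier_mat d d" "adj_mat A * A = 1\<^sub>m d" "det A = 1"
    using adj_mat[of A d] by (auto simp: SL_def)
  moreover from this have "det (adj_mat A) = 1"
    using A det_mult[of "adj_mat A" d A] by (auto simp: SL_def)
  ultimately show "\<exists>y\<in>carrier (SL d). y \<otimes>\<^bsub>SL d\<^esub> A = \<one>\<^bsub>SL d\<^esub>"
    by (auto simp: SL_def)
qed (auto simp: SL_def det_mult assoc_mult_mat[of _ d d _ d _ d])

definition word_eval :: "('g, 'c) monoid_scheme \<Rightarrow> ('a \<Rightarrow> 'g) \<Rightarrow> 'a word \<Rightarrow> 'g" where
  "word_eval G f w = foldr (\<lambda>(x, s) g. (if s then inv\<^bsub>G\<^esub> f x else f x) \<otimes>\<^bsub>G\<^esub> g) w \<one>\<^bsub>G\<^esub>"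

context group begin

lemma word_eval_closed: "(\<And>x. f x \<in> carrier G) \<Longrightarrow> word_eval G f w \<in> carrier G"
  unfolding word_eval_def by (induction w) auto

lemma word_eval_append:
  "(\<And>x. f x \<in> carrier G) \<Longrightarrow> word_eval G f (u @ v) = word_eval G f u \<otimes> word_eval G f v"
proof (induction u)
  case Nil
  then show ?case using word_eval_closed[of f v] by (simp add: word_eval_def)
next
  case (Cons a u)
  show ?case using Cons word_eval_closed[of f v] word_eval_closed[of f u]
    by (cases a) (simp add: word_eval_def m_assoc)
qed

lemma word_eval_pres_eq:
  assumes f: "\<And>x. f x \<in> carrier G" and "\<And>r. r \<in> R \<Longrightarrow> word_eval G f r = \<one>"
  shows "pres_eq R u v \<Longrightarrow> word_eval G f u = word_eval G f v"
proof (induction rule: pres_eq.induct)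
  case (cancel u x s v)
  have "word_eval G f [(x, s), (x, \<not> s)] = \<one>"
    using f by (simp add: word_eval_def)
  then show ?case
    using word_eval_closed[of f, OF f] word_eval_append[of f, OF f]
      word_eval_append[of f u "[(x, s), (x, \<not> s)] @ v", OF f]
      word_eval_append[of f "[(x, s), (x, \<not> s)]" v, OF f] by simp
next
  case (relator r u v)
  then show ?case
    using word_eval_closed[of f, OF f] word_eval_append[of f, OF f] assms(2) by simp
qed auto

lemma pres_group_hom_exists:
  assumes f: "\<And>x. f x \<in> carrier G" and R: "\<And>r. r \<in> R \<Longrightarrow> word_eval G f r = \<one>"
  shows "\<exists>h \<in> hom (pres_group R) G. \<forall>x. h (word_class R (gen x)) = f x"
proof -
  define h where "h A = word_eval G f (SOME w. w \<in> A)" for A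
  have h: "h (word_class R w) = word_eval G f w" for w
  proof -
    have "(SOME v. v \<in> word_class R w) \<in> word_class R w"
      by (rule someI[of _ w]) (auto simp: word_class_def intro: pres_eq.intros)
    then show ?thesis unfolding h_def
      using word_eval_pres_eq[of f R, OF f R] by (auto simp: word_class_def)
  qed
  have "h \<in> hom (pres_group R) G"
    using word_eval_closed[of f, OF f] word_eval_append[of f, OF f]
    by (auto simp: hom_def pres_group_carrier h word_class_mult)
  moreover have "h (word_class R (gen x)) = f x" for x
    using f by (simp add: h gen_def word_eval_def)
  ultimately show ?thesis by blast
qed

end

definition dmat :: "complex \<Rightarrow> complex mat" where
  "dmat z = mat_of_rows_list 2 [[z, 0], [0, inverse z]]"

definition emat :: "complex \<Rightarrow> complex mat" where
  "emat z = mat_of_rows_list 2 [[0, z], [- inverse z, 0]]"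

lemma det_mat2: "A \<in> carrier_mat 2 2 \<Longrightarrow> det A = A $$ (0,0) * A $$ (1,1) - A $$ (0,1) * A $$ (1,0)"
  by (subst laplace_expansion_row[of A 2 0])
     (auto simp: cofactor_def mat_delete_def det_single numeral_2_eq_2)

lemma dmat_carrier [simp]: "z \<noteq> 0 \<Longrightarrow> dmat z \<in> carrier (SL 2)"
  by (auto simp: SL_def dmat_def mat_of_rows_list_def det_mat2 numeral_2_eq_2)

lemma emat_carrier [simp]: "z \<noteq> 0 \<Longrightarrow> emat z \<in> carrier (SL 2)"
  by (auto simp: SL_def emat_def mat_of_rows_list_def det_mat2 numeral_2_eq_2)

lemma dmat_mult:
  "dmat a * dmat b = dmat (a * b)"
  "dmat a * emat b = emat (a * b)"
  "emat a * dmat b = emat (a * inverse b)"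
  "emat a * emat b = dmat (- a * inverse b)"
  by (rule eq_matI;
      auto simp: dmat_def emat_def mat_of_rows_list_def scalar_prod_def less_Suc_eq numeral_2_eq_2)+

lemma SL_mult [simp]: "A \<otimes>\<^bsub>SL d\<^esub> B = A * B" and SL_one: "\<one>\<^bsub>SL d\<^esub> = 1\<^sub>m d"
  by (simp_all add: SL_def)

lemma dmat_1: "dmat 1 = 1\<^sub>m 2"
  by (rule eq_matI) (auto simp: dmat_def mat_of_rows_list_def less_Suc_eq numeral_2_eq_2)

lemma dmat_inv: "z \<noteq> 0 \<Longrightarrow> inv\<^bsub>SL 2\<^esub> dmat z = dmat (inverse z)"
  using group.inv_equality[OF group_SL, of 2 "dmat (inverse z)" "dmat z"]
  by (simp add: dmat_mult dmat_1 SL_one)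

lemma emat_inv: "z \<noteq> 0 \<Longrightarrow> inv\<^bsub>SL 2\<^esub> emat z = emat (- z)"
  using group.inv_equality[OF group_SL, of 2 "emat (- z)" "emat z"]
  by (simp add: dmat_mult dmat_1 SL_one)

lemma dmat_ex: "z \<noteq> 0 \<Longrightarrow> \<exists>w. w \<noteq> 0 \<and> dmat z = dmat w"
  by blast

lemma metabelian_if_monomial:
  assumes G: "group G" and h: "\<rho> \<in> hom G (SL 2)"
    and mono: "\<And>g. g \<in> carrier G \<Longrightarrow> \<exists>z. z \<noteq> 0 \<and> (\<rho> g = dmat z \<or> \<rho> g = emat z)"
  shows "metabelian_rep G \<rho>"
proof -
  interpret G: group G by fact
  interpret SL: group "SL 2" by (rule group_SL)
  interpret H: group_hom G "SL 2" \<rho>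
    using h by unfold_locales
  have comm: "\<exists>z. z \<noteq> 0 \<and> \<rho> g = dmat z" if "g \<in> derived_set G (carrier G)" for g
  proof -
    from that obtain a b where ab: "a \<in> carrier G" "b \<in> carrier G"
      "g = a \<otimes>\<^bsub>G\<^esub> b \<otimes>\<^bsub>G\<^esub> inv\<^bsub>G\<^esub> a \<otimes>\<^bsub>G\<^esub> inv\<^bsub>G\<^esub> b" by auto
    then have "\<rho> g = \<rho> a * \<rho> b * inv\<^bsub>SL 2\<^esub> \<rho> a * inv\<^bsub>SL 2\<^esub> \<rho> b"
      using H.hom_mult by (simp add: H.hom_inv)
    then show ?thesis using mono[OF ab(1)] mono[OF ab(2)]
      by (elim exE conjE disjE) (simp_all add: dmat_mult dmat_inv emat_inv dmat_ex)
  qed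
  have sub: "derived_set G (carrier G) \<subseteq> carrier G"
    by auto
  have "\<exists>z. z \<noteq> 0 \<and> \<rho> g = dmat z" if "g \<in> derived G (carrier G)" for g
    using that unfolding derived_def
  proof (induction rule: generate.induct)
    case one
    then show ?case using H.hom_one by (simp add: SL_one dmat_1[symmetric] dmat_ex)
  next
    case (incl h)
    then show ?case by (rule comm)
  next
    case (inv h)
    then obtain z where "z \<noteq> 0" "\<rho> h = dmat z" using comm by blast
    moreover have "h \<in> carrier G" using inv sub by blast
    ultimately show ?case
      by (metis H.hom_inv dmat_inv inverse_nonzero_iff_nonzero)
  next
    case (eng h1 h2)
    then have "h1 \<in> carrier G" "h2 \<in> carrier G"
      using G.generate_in_carrier[OF sub] by auto
    then show ?case using eng.IH H.hom_mult
      by (elim exE conjE) (simp add: dmat_mult dmat_ex)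
  qed
  then show ?thesis
    unfolding metabelian_rep_def by (metis dmat_mult(1) mult.commute)
qed

lemma irreducible_if:
  assumes g: "g \<in> carrier G" "\<rho> g = dmat a" and h: "h \<in> carrier G" "\<rho> h = emat 1"
    and a: "a \<noteq> inverse a"
  shows "irreducible_rep G 2 \<rho>"
  unfolding irreducible_rep_def
proof (intro conjI allI impI)
  fix W :: "complex vec set"
  assume W: "W \<subseteq> carrier_vec 2" and "0\<^sub>v 2 \<in> W \<and> (\<forall>v\<in>W. \<forall>w\<in>W. v + w \<in> W) \<and>
    (\<forall>c. \<forall>v\<in>W. c \<cdot>\<^sub>v v \<in> W) \<and> (\<forall>g\<in>carrier G. \<forall>v\<in>W. \<rho> g *\<^sub>v v \<in> W)"
  then have W0: "0\<^sub>v 2 \<in> W" and add: "\<And>v w. v \<in> W \<Longrightarrow> w \<in> W \<Longrightarrow> v + w \<in> W"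
    and sm: "\<And>c v. v \<in> W \<Longrightarrow> c \<cdot>\<^sub>v v \<in> W"
    and inv1: "\<And>v. v \<in> W \<Longrightarrow> dmat a *\<^sub>v v \<in> W" and inv2: "\<And>v. v \<in> W \<Longrightarrow> emat 1 *\<^sub>v v \<in> W"
    using g h by metis+
  define vv where "vv x y = vec_of_list [x, y]" for x y :: complex
  have vv: "v = vv (v $ 0) (v $ 1)" if "v \<in> carrier_vec 2" for v
    using that by (intro eq_vecI) (auto simp: vv_def vec_of_list_index less_Suc_eq numeral_2_eq_2)
  have ops: "vv x y + vv x' y' = vv (x + x') (y + y')" "c \<cdot>\<^sub>v vv x y = vv (c * x) (c * y)"
    "dmat a *\<^sub>v vv x y = vv (a * x) (inverse a * y)" "emat 1 *\<^sub>v vv x y = vv y (- x)"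
    for x y x' y' c
    by (rule eq_vecI; auto simp: vv_def vec_of_list_index less_Suc_eq numeral_2_eq_2 dmat_def emat_def
        mat_of_rows_list_def scalar_prod_def)+
  show "W = {0\<^sub>v 2} \<or> W = carrier_vec 2"
  proof (cases "W = {0\<^sub>v 2}")
    case False
    then obtain v where v: "v \<in> W" "v \<noteq> 0\<^sub>v 2" using W0 by blast
    have vc: "v = vv (v $ 0) (v $ 1)" using v W by (intro vv) blast
    have z: "vv 0 0 = 0\<^sub>v 2"
      by (rule eq_vecI) (auto simp: vv_def vec_of_list_index less_Suc_eq numeral_2_eq_2)
    have "v $ 0 \<noteq> 0 \<or> v $ 1 \<noteq> 0" using vc v z by metis
    then obtain x y where xy: "vv x y \<in> W" "x \<noteq> 0 \<or> y \<noteq> 0"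
      using v vc by metis
    have "\<exists>x y. vv x y \<in> W \<and> x \<noteq> 0"
      using xy inv2[OF xy(1)] by (auto simp: ops)
    then obtain x y where xy: "vv x y \<in> W" "x \<noteq> 0" by blast
    have "dmat a *\<^sub>v vv x y + (- inverse a) \<cdot>\<^sub>v vv x y \<in> W"
      by (intro add sm inv1 xy)
    then have *: "vv ((a - inverse a) * x) 0 \<in> W" by (simp add: ops algebra_simps)
    have e0: "vv s 0 \<in> W" for s
      using sm[OF *, of "s / ((a - inverse a) * x)"] a xy by (simp add: ops)
    have e1: "vv 0 s \<in> W" for s
      using inv2[OF e0[of "- s"]] by (simp add: ops)
    have "vv s t \<in> W" for s t
      using add[OF e0[of s] e1[of t]] by (simp add: ops)
    then have "carrier_vec 2 \<subseteq> W" using vv by (metis subsetI)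
    then have "W = carrier_vec 2" using W by blast
    then show ?thesis ..
  qed simp
qed simp

lemma word_pow_Suc: "word_pow w (Suc k) = w @ word_pow w k" and word_pow_0: "word_pow w 0 = []"
  by (simp_all add: word_pow_def)

lemma twist_metabelian_rep_exists:
  assumes mn: "m \<ge> 1" "n \<ge> 1" "1 \<le> i" "i \<le> 2 * m * n - 1"
    and \<xi>: "\<xi> = exp (2 * of_real pi * \<i> / (4 * of_nat m * of_nat n - 1))"
  shows "\<exists>\<rho>. \<rho> \<in> hom (twist_group m n) (SL 2) \<and>
    irreducible_rep (twist_group m n) 2 \<rho> \<and> metabelian_rep (twist_group m n) \<rho> \<and>
    \<rho> (twist_elt m n X1) = mat_of_rows_list 2 [[\<xi> ^ i, 0], [0, inverse (\<xi> ^ i)]] \<and>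
    \<rho> (twist_elt m n X2) =
      mat_of_rows_list 2 [[\<xi> ^ (2 * m * i), 0], [0, inverse (\<xi> ^ (2 * m * i))]] \<and>
    \<rho> (twist_elt m n Mu) = mat_of_rows_list 2 [[0, 1], [-1, 0]]"
proof -
  interpret SL: group "SL 2" by (rule group_SL)
  define a b where "a = \<xi> ^ i" and "b = \<xi> ^ (2 * m * i)"
  have a0: "a \<noteq> 0" and b0: "b \<noteq> 0" by (auto simp: a_def b_def \<xi>)
  have ba: "b = a ^ (2 * m)" unfolding a_def b_def by (metis power_mult mult.commute)
  have mn1: "m * n \<ge> 1" using mn by simp
  have \<xi>c: "\<xi> = cis (2 * pi / (4 * real m * real n - 1))"
    by (simp add: \<xi> cis_conv_exp mult_ac)
  have q: "4 * real m * real n - 1 = real (4 * m * n - 1)" "real (4 * m * n - 1) > 0"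
  proof -
    define k where "k = m * n"
    have k: "4 * m * n = 4 * k" "4 * real m * real n = 4 * real k" by (simp_all add: k_def)
    have "k \<ge> 1" using mn1 by (simp only: k_def)
    then show "4 * real m * real n - 1 = real (4 * m * n - 1)" "real (4 * m * n - 1) > 0"
      unfolding k by (simp_all add: of_nat_diff)
  qed
  have \<xi>1: "\<xi> ^ (4 * m * n - 1) = 1"
    unfolding \<xi>c q(1) DeMoivre using q(2) by simp
  have a1: "a ^ (4 * m * n) = a"
  proof -
    have "a ^ (4 * m * n - 1) = 1"
      unfolding a_def using \<xi>1 by (metis mult.commute power_mult power_one)
    then have "a ^ Suc (4 * m * n - 1) = a" by simp
    moreover have "Suc (4 * m * n - 1) = 4 * m * n" using q by linarith
    ultimately show ?thesis by metis
  qed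
  define f where "f x = (case x of X1 \<Rightarrow> dmat a | X2 \<Rightarrow> dmat b | Mu \<Rightarrow> emat 1)" for x
  have f: "f x \<in> carrier (SL 2)" for x using a0 b0 by (cases x) (auto simp: f_def)
  have pow: "word_eval (SL 2) f (word_pow (gen X1) k) = dmat (a ^ k)"
    "word_eval (SL 2) f (word_pow (gen_inv X1) k) = dmat (inverse a ^ k)"
    "word_eval (SL 2) f (word_pow (gen X2) k) = dmat (b ^ k)"
    "word_eval (SL 2) f (word_pow (gen_inv X2) k) = dmat (inverse b ^ k)" for k
    using a0 b0
    by (induction k; simp add: word_pow_0 word_pow_Suc word_eval_def gen_def gen_inv_def f_def
        dmat_mult dmat_1 SL_one dmat_inv)+
  have one: "word_eval (SL 2) f (gen X1) = dmat a" "word_eval (SL 2) f (gen X2) = dmat b"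
    "word_eval (SL 2) f (gen Mu) = emat 1" "word_eval (SL 2) f (gen_inv Mu) = emat (- 1)"
    by (simp_all add: word_eval_def gen_def gen_inv_def f_def SL_one dmat_1[symmetric]
        dmat_mult emat_inv del: SL_mult) (simp_all add: dmat_mult)
  have r1: "word_eval (SL 2) f (rel1 m) = \<one>\<^bsub>SL 2\<^esub>"
    using a0 b0 by (simp add: rel1_def SL.word_eval_append[of f, OF f] pow one dmat_mult
        SL_one dmat_1[symmetric] ba field_simps power_mult power2_eq_square power_mult_distrib)
  have r2: "word_eval (SL 2) f (rel2 n) = \<one>\<^bsub>SL 2\<^esub>"
  proof -
    have "b ^ n * b ^ n = a" unfolding ba using a1
      by (simp add: power_mult[symmetric] power_add[symmetric] mult_2[symmetric] mult_ac)
    then show ?thesis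
      using a0 b0 by (simp add: rel2_def SL.word_eval_append[of f, OF f] pow one dmat_mult
        SL_one dmat_1[symmetric] field_simps)
  qed
  obtain \<rho> where \<rho>: "\<rho> \<in> hom (twist_group m n) (SL 2)" "\<And>x. \<rho> (twist_elt m n x) = f x"
    using SL.pres_group_hom_exists[of f "twist_rels m n", OF f] r1 r2
    unfolding twist_elt_def by auto
  interpret P: group "twist_group m n" by (rule group_pres_group)
  interpret H: group_hom "twist_group m n" "SL 2" \<rho> using \<rho> by unfold_locales
  have mono: "\<exists>z. z \<noteq> 0 \<and> (\<rho> (word_class (twist_rels m n) w) = dmat z
    \<or> \<rho> (word_class (twist_rels m n) w) = emat z)" for w
  proof (induction w)
    case Nil
    then show ?case using H.hom_one dmat_1 by (metis SL_one word_class_one one_neq_zero)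
  next
    case (Cons l w)
    let ?c = "word_class (twist_rels m n)"
    obtain x s where l: "l = (x, s)" by force
    have gx: "?c (gen x) \<in> carrier (twist_group m n)" for x by (simp add: pres_group_carrier)
    have "?c (gen_inv x) \<otimes>\<^bsub>twist_group m n\<^esub> ?c (gen x) = \<one>\<^bsub>twist_group m n\<^esub>"
      using pres_eq.cancel[of "twist_rels m n" "[]" x True "[]"]
      by (simp add: word_class_mult word_class_one word_class_eq_iff gen_def gen_inv_def)
    then have "?c (gen_inv x) = inv\<^bsub>twist_group m n\<^esub> ?c (gen x)"
      by (metis P.inv_equality gx pres_group_carrier rangeI)
    then have i: "\<rho> (?c (gen_inv x)) = inv\<^bsub>SL 2\<^esub> f x"
      using \<rho>(2)[of x] H.hom_inv[OF gx] by (simp add: twist_elt_def)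
    have "\<rho> (?c [l]) = f x \<or> \<rho> (?c [l]) = inv\<^bsub>SL 2\<^esub> f x"
      using i \<rho>(2)[of x] by (cases s) (auto simp: l gen_def gen_inv_def twist_elt_def)
    then have "\<exists>z. z \<noteq> 0 \<and> (\<rho> (?c [l]) = dmat z \<or> \<rho> (?c [l]) = emat z)"
      using a0 b0 by (cases x) (auto simp: f_def dmat_inv emat_inv
          intro: exI[of _ "1::complex"] exI[of _ "-1::complex"] exI[of _ a] exI[of _ b]
            exI[of _ "inverse a"] exI[of _ "inverse b"])
    then obtain z where z: "z \<noteq> 0" "\<rho> (?c [l]) = dmat z \<or> \<rho> (?c [l]) = emat z" by blast
    obtain y where y: "y \<noteq> 0" "\<rho> (?c w) = dmat y \<or> \<rho> (?c w) = emat y" using Cons by blast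
    have "\<rho> (?c (l # w)) = \<rho> (?c [l]) * \<rho> (?c w)"
      using H.hom_mult[of "?c [l]" "?c w"] by (simp add: word_class_mult pres_group_carrier)
    moreover have "z * y \<noteq> 0" "z * inverse y \<noteq> 0" "- z * inverse y \<noteq> 0" using z y by auto
    ultimately show ?case using z(2) y(2) dmat_mult by metis
  qed
  have met: "metabelian_rep (twist_group m n) \<rho>"
    by (rule metabelian_if_monomial) (use mono \<rho> in \<open>auto simp: pres_group_carrier group_pres_group\<close>)
  have "a \<noteq> inverse a"
  proof
    assume "a = inverse a"
    then have "a * a = 1" using a0 by (metis right_inverse)
    then have "a = 1 \<or> a = - 1" by (simp add: square_eq_1_iff)
    then have "Im a = 0" by auto
    moreover have "Im a = sin (real i * (2 * pi / (4 * real m * real n - 1)))"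
      unfolding a_def \<xi>c DeMoivre by simp
    moreover have "sin (real i * (2 * pi / (4 * real m * real n - 1))) > 0"
    proof (rule sin_gt_zero)
      have "2 * real i < real (4 * m * n - 1)" using mn mn1 by linarith
      then show "real i * (2 * pi / (4 * real m * real n - 1)) < pi"
        unfolding q(1) using q(2) pi_gt_zero by (simp add: field_simps)
      show "0 < real i * (2 * pi / (4 * real m * real n - 1))"
        unfolding q(1) using q(2) mn by simp
    qed
    ultimately show False by simp
  qed
  then have irr: "irreducible_rep (twist_group m n) 2 \<rho>"
    using \<rho>(2)[of X1] \<rho>(2)[of Mu]
    by (intro irreducible_if[of "twist_elt m n X1" _ _ a "twist_elt m n Mu"])
       (auto simp: f_def twist_elt_def pres_group_carrier)
  show ?thesis
    using \<rho> met irr by (intro exI[of _ \<rho>]) (simp add: f_def dmat_def emat_def a_def b_def)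
qed

end

theory Submission
  imports Defs "HOL-Number_Theory.Cong"
begin

text \<open>In the weight basis of the homogeneous polynomials of degree \<open>2N - 1\<close>, \<open>x\<^sub>1\<close> and \<open>x\<^sub>2\<close> act
  diagonally and \<open>\<mu>\<close> interchanges the weights \<open>k\<close> and \<open>-k\<close>. Hence every Fox block is supported on the
  diagonal and the antidiagonal, and after a Schur complement the torsion becomes a product over
  \<open>z = \<xi>^(-i k)\<close>, \<open>k = 1, 3, \<dots>, 2N - 1\<close>, of \<open>2 \<times> 2\<close> determinants divided by \<open>2\<close>. Such a determinant is
  \<open>(2mn - 1)^2\<close> if \<open>z = 1\<close>, and otherwise has modulus
  \<open>4 \<bar>(z^m - 1) / (z - 1)\<bar>^2 \<bar>(z^(2mn) - 1) / (z^(2m) - 1)\<bar>^2\<close>.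
  As \<open>m\<close>, \<open>2m\<close> and \<open>2mn\<close> are prime to \<open>q\<close>, these powers permute the \<open>q\<close>-th roots of unity, so the
  quotients cancel over one period of \<open>k\<close>, and the logarithms have the asserted Cesaro mean.\<close>

section \<open>Linear extensions and Fox derivatives\<close>

text \<open>Scalar-valued counterpart of \<open>gr_lin_ext\<close>: it gives each matrix entry of
  the latter, so that the Fox blocks can be computed entry by entry.\<close>

definition lin_ext :: "('g \<Rightarrow> 'b) \<Rightarrow> ('g \<Rightarrow>\<^sub>0 int) \<Rightarrow> 'b::comm_ring_1" where
  "lin_ext h a = (\<Sum>g\<in>Poly_Mapping.keys a. of_int (Poly_Mapping.lookup a g) * h g)"

text \<open>Cancellation can shrink the support of a sum, so linear extensions are compared over a
  common finite superset of the supports, where the extra terms vanish.\<close>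

lemma lin_ext_superset:
  assumes "finite S" "Poly_Mapping.keys a \<subseteq> S"
  shows "lin_ext h a = (\<Sum>g\<in>S. of_int (Poly_Mapping.lookup a g) * h g)"
  unfolding lin_ext_def using assms
  by (intro sum.mono_neutral_left) (auto simp: in_keys_iff)

lemma lin_ext_0 [simp]: "lin_ext h 0 = 0"
  by (simp add: lin_ext_def)

lemma lin_ext_single [simp]: "lin_ext h (Poly_Mapping.single g c) = of_int c * h g"
  by (subst lin_ext_superset[of "{g}"]) auto

lemma lin_ext_add [simp]: "lin_ext h (a + b) = lin_ext h a + lin_ext h b"
proof -
  let ?S = "Poly_Mapping.keys a \<union> Poly_Mapping.keys b"
  have "Poly_Mapping.keys (a + b) \<subseteq> ?S" by (rule keys_add)
  then show ?thesis
    by (simp add: lin_ext_superset[of ?S] lookup_add algebra_simps sum.distrib)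
qed

lemma lin_ext_uminus [simp]: "lin_ext h (- a) = - lin_ext h a"
  by (simp add: lin_ext_def sum_negf)

lemma lin_ext_diff [simp]: "lin_ext h (a - b) = lin_ext h a - lin_ext h b"
  using lin_ext_add[of h a "- b"] by simp

lemma lin_ext_sum: "lin_ext h (sum f S) = (\<Sum>s\<in>S. lin_ext h (f s))"
  by (induction S rule: infinite_finite_induct) auto

lemma lin_ext_gr_map: "lin_ext h (gr_map f a) = lin_ext (\<lambda>g. h (f g)) a"
  unfolding gr_map_def lin_ext_sum by (simp only: lin_ext_single) (simp add: lin_ext_def)

lemma lin_ext_gr_lmult: "lin_ext h (gr_lmult G g a) = lin_ext (\<lambda>x. h (g \<otimes>\<^bsub>G\<^esub> x)) a"
  unfolding gr_lmult_def lin_ext_sum by (simp only: lin_ext_single) (simp add: lin_ext_def)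

lemma gr_lin_ext_index:
  "i < d \<Longrightarrow> j < d \<Longrightarrow> gr_lin_ext d \<phi> a $$ (i, j) = lin_ext (\<lambda>g. \<phi> g $$ (i, j)) a"
  by (simp add: gr_lin_ext_def lin_ext_def)

text \<open>\<open>fox_at f x u w\<close> is \<open>u\<close> times the Fox derivative of \<open>w\<close>, with \<open>f\<close> applied linearly.\<close>

fun fox_at :: "('a word \<Rightarrow> 'b) \<Rightarrow> 'a \<Rightarrow> 'a word \<Rightarrow> 'a word \<Rightarrow> 'b::ab_group_add" where
  "fox_at f x u [] = 0"
| "fox_at f x u ((y, False) # w) = (if y = x then f u else 0) + fox_at f x (u @ gen y) w"
| "fox_at f x u ((y, True) # w) =
    - (if y = x then f (u @ gen_inv y) else 0) + fox_at f x (u @ gen_inv y) w"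

text \<open>Both sides consist of the words equivalent to some product of words from the three sets.
  It is stated for arbitrary sets of words because \<open>A\<close> ranges over all of them in
  \<open>lin_ext_fox\<close>.\<close>

lemma pres_group_mult_assoc:
  "A \<otimes>\<^bsub>pres_group R\<^esub> (B \<otimes>\<^bsub>pres_group R\<^esub> C) = A \<otimes>\<^bsub>pres_group R\<^esub> B \<otimes>\<^bsub>pres_group R\<^esub> C"
proof (rule Set.set_eqI, rule iffI)
  fix w assume "w \<in> A \<otimes>\<^bsub>pres_group R\<^esub> (B \<otimes>\<^bsub>pres_group R\<^esub> C)"
  then obtain a b c v where "a \<in> A" "b \<in> B" "c \<in> C" "pres_eq R (b @ c) v" "pres_eq R (a @ v) w"
    by (auto simp: pres_group_def)
  moreover from this have "pres_eq R ((a @ b) @ c) w"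
    using pres_eq_append2[OF pres_eq.refl, of R "b @ c" v a] by (auto intro: pres_eq.trans)
  ultimately have "\<exists>v\<in>{w. \<exists>u\<in>A. \<exists>v\<in>B. pres_eq R (u @ v) w}. \<exists>c\<in>C. pres_eq R (v @ c) w"
    by (intro bexI[of _ "a @ b"] bexI[of _ c]) (auto intro: pres_eq.refl)
  then show "w \<in> A \<otimes>\<^bsub>pres_group R\<^esub> B \<otimes>\<^bsub>pres_group R\<^esub> C"
    by (simp add: pres_group_def)
next
  fix w assume "w \<in> A \<otimes>\<^bsub>pres_group R\<^esub> B \<otimes>\<^bsub>pres_group R\<^esub> C"
  then obtain a b c v where "a \<in> A" "b \<in> B" "c \<in> C" "pres_eq R (a @ b) v" "pres_eq R (v @ c) w"
    by (auto simp: pres_group_def)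
  moreover from this have "pres_eq R (a @ b @ c) w"
    using pres_eq_append2[OF _ pres_eq.refl, of R "a @ b" v c] by (auto intro: pres_eq.trans)
  ultimately have "\<exists>a\<in>A. \<exists>v\<in>{w. \<exists>u\<in>B. \<exists>v\<in>C. pres_eq R (u @ v) w}. pres_eq R (a @ v) w"
    by (intro bexI[of _ a] bexI[of _ "b @ c"]) (auto intro: pres_eq.refl)
  then show "w \<in> A \<otimes>\<^bsub>pres_group R\<^esub> (B \<otimes>\<^bsub>pres_group R\<^esub> C)"
    by (simp add: pres_group_def)
qed

lemma pres_eq_mono: "pres_eq R u v \<Longrightarrow> R \<subseteq> R' \<Longrightarrow> pres_eq R' u v"
proof (induction rule: pres_eq.induct)
  case (cancel u x s v)
  show ?case by (rule pres_eq.cancel)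
qed (auto intro: pres_eq.intros)

lemma pres_proj_word_class: "pres_proj R (word_class {} w) = word_class R w"
  using pres_eq_mono[of "{}" _ _ R]
  by (auto simp: pres_proj_def word_class_def intro: pres_eq.intros)

text \<open>The prefix \<open>u\<close> collects the letters already read, so the nested left
  multiplications in \<open>fox\<close> become a single evaluation of \<open>h\<close> for each
  occurrence of \<open>x\<close>.\<close>

lemma lin_ext_fox:
  "lin_ext (\<lambda>A. h (pres_proj R (word_class {} u \<otimes>\<^bsub>free_group\<^esub> A))) (fox x w)
    = fox_at (\<lambda>v. h (word_class R v)) x u w"
proof (induction w arbitrary: u rule: fox.induct)
  case (2 x y w)
  show ?case
    using 2[of "u @ gen y"]
    by (simp add: lin_ext_gr_lmult pres_group_mult_assoc word_class_mult pres_proj_word_class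
        word_class_one del: One_nat_def)
next
  case (3 x y w)
  show ?case
    using 3[of "u @ gen_inv y"]
    by (simp add: lin_ext_gr_lmult pres_group_mult_assoc word_class_mult pres_proj_word_class)
qed simp

section \<open>Matrices supported on the diagonal and the antidiagonal\<close>

definition cross :: "nat \<Rightarrow> (nat \<Rightarrow> 'a) \<Rightarrow> (nat \<Rightarrow> 'a) \<Rightarrow> 'a::comm_ring_1 mat" where
  "cross N f g = mat (2 * N) (2 * N)
     (\<lambda>(i, j). if j = i then f i else if j = 2 * N - 1 - i then g i else 0)"

lemma cross_carrier [simp]: "cross N f g \<in> carrier_mat (2 * N) (2 * N)"
  by (simp add: cross_def)

lemma cross_dim [simp]: "dim_row (cross N f g) = 2 * N" "dim_col (cross N f g) = 2 * N"
  by (simp_all add: cross_def)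

lemma cross_index:
  "i < 2 * N \<Longrightarrow> j < 2 * N \<Longrightarrow>
    cross N f g $$ (i, j) = (if j = i then f i else if j = 2 * N - 1 - i then g i else 0)"
  by (simp add: cross_def)

text \<open>As 2N - 1 is odd, the mirror map on the indices has no fixed point: diagonal and
  antidiagonal are disjoint.\<close>

lemma reflect_neq: "i < 2 * N \<Longrightarrow> 2 * N - Suc i \<noteq> (i::nat)"
proof
  assume "i < 2 * N" "2 * N - Suc i = i"
  then have "2 * i + 1 = 2 * N" by linarith
  then show False by presburger
qed

lemma cross_cong:
  "(\<And>i. i < 2 * N \<Longrightarrow> f i = f' i) \<Longrightarrow> (\<And>i. i < 2 * N \<Longrightarrow> g i = g' i) \<Longrightarrow> cross N f g = cross N f' g'"
  by (rule eq_matI) (auto simp: cross_index)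

lemma cross_minus: "cross N f g - cross N f' g' = cross N (\<lambda>i. f i - f' i) (\<lambda>i. g i - g' i)"
  by (rule eq_matI) (auto simp: cross_index)

lemma cross_mult:
  "cross N f g * cross N f' g' =
    cross N (\<lambda>i. f i * f' i + g i * g' (2 * N - 1 - i)) (\<lambda>i. f i * g' i + g i * f' (2 * N - 1 - i))"
proof (rule eq_matI)
  fix i j assume "i < dim_row (cross N (\<lambda>i. f i * f' i + g i * g' (2 * N - 1 - i))
      (\<lambda>i. f i * g' i + g i * f' (2 * N - 1 - i)))"
    "j < dim_col (cross N (\<lambda>i. f i * f' i + g i * g' (2 * N - 1 - i))
      (\<lambda>i. f i * g' i + g i * f' (2 * N - 1 - i)))"
  then have ij: "i < 2 * N" "j < 2 * N" by simp_all
  define r where "r = 2 * N - 1 - i"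
  have r: "r < 2 * N" "r \<noteq> i" "2 * N - Suc r = i" "2 * N - Suc i = r"
    using ij reflect_neq[of i N] by (simp_all add: r_def)
  have "(cross N f g * cross N f' g') $$ (i, j) =
      (\<Sum>k<2 * N. cross N f g $$ (i, k) * cross N f' g' $$ (k, j))"
    using ij by (simp add: times_mat_def scalar_prod_def lessThan_atLeast0)
  \<comment> \<open>Row \<open>i\<close> of a cross matrix is supported on the column
    \<open>i\<close> and its mirror image \<open>r\<close>.\<close>
  also have "\<dots> = (\<Sum>k\<in>{i, r}. cross N f g $$ (i, k) * cross N f' g' $$ (k, j))"
    using ij r by (intro sum.mono_neutral_right) (auto simp: cross_index r)
  also have "\<dots> = f i * cross N f' g' $$ (i, j) + g i * cross N f' g' $$ (r, j)"
    using ij r by (simp add: cross_index)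
  finally show "(cross N f g * cross N f' g') $$ (i, j) =
      cross N (\<lambda>i. f i * f' i + g i * g' (2 * N - 1 - i))
        (\<lambda>i. f i * g' i + g i * f' (2 * N - 1 - i)) $$ (i, j)"
    using ij r by (auto simp: cross_index)
qed simp_all

lemma det_diag: "det (mat n n (\<lambda>(i, j). if j = i then f i else 0)) = (\<Prod>i<n. f i :: 'a::comm_ring_1)"
proof -
  let ?D = "mat n n (\<lambda>(i, j). if j = i then f i else 0)"
  have "upper_triangular ?D" by auto
  then have "det ?D = prod_list (diag_mat ?D)"
    by (rule det_upper_triangular[of _ n]) simp
  also have "\<dots> = prod_list (map f [0..<n])"
    by (rule arg_cong[of _ _ prod_list]) (auto simp: diag_mat_def)
  finally show ?thesis by (simp add: prod.distinct_set_conv_list[symmetric] lessThan_atLeast0)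
qed

text \<open>Conjugating by the reversal of the last \<open>N\<close> basis vectors turns the four blocks of a cross
  matrix into commuting diagonal matrices.\<close>

lemma det_cross:
  fixes f g :: "nat \<Rightarrow> 'a::idom"
  shows "det (cross N f g) = (\<Prod>j<N. f j * f (2 * N - 1 - j) - g j * g (2 * N - 1 - j))"
proof -
  let ?D = "\<lambda>h. mat N N (\<lambda>(i, j). if j = i then h i else 0) :: 'a mat"
  let ?J = "mat N N (\<lambda>(i, j). if j = N - 1 - i then 1 else 0) :: 'a mat"
  let ?r = "\<lambda>i. 2 * N - 1 - i"
  let ?P = "four_block_mat (1\<^sub>m N) (0\<^sub>m N N) (0\<^sub>m N N) ?J"
  let ?X = "four_block_mat (?D f) (?D g) (?D (\<lambda>i. g (?r i))) (?D (\<lambda>i. f (?r i)))"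
  have JJ: "?J * ?J = 1\<^sub>m N"
  proof (rule eq_matI)
    fix i j assume "i < dim_row (1\<^sub>m N :: 'a mat)" "j < dim_col (1\<^sub>m N :: 'a mat)"
    then have ij: "i < N" "j < N" by simp_all
    have "(?J * ?J) $$ (i, j) = (\<Sum>k<N. ?J $$ (i, k) * ?J $$ (k, j))"
      using ij by (simp add: times_mat_def scalar_prod_def lessThan_atLeast0)
    also have "\<dots> = (\<Sum>k\<in>{N - 1 - i}. ?J $$ (i, k) * ?J $$ (k, j))"
      using ij by (intro sum.mono_neutral_right) auto
    finally show "(?J * ?J) $$ (i, j) = 1\<^sub>m N $$ (i, j)" using ij by auto
  qed simp_all
  have P: "det ?P = det ?J"
    by (subst det_four_block_mat_upper_right_zero[of _ N _ N]) auto
  have DJ: "?D h * ?J = mat N N (\<lambda>(i, j). if j = N - 1 - i then h i else 0)" for h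
  proof (rule eq_matI)
    fix i j assume "i < dim_row (mat N N (\<lambda>(i, j). if j = N - 1 - i then h i else 0))"
      "j < dim_col (mat N N (\<lambda>(i, j). if j = N - 1 - i then h i else 0))"
    then have ij: "i < N" "j < N" by simp_all
    have "(?D h * ?J) $$ (i, j) = (\<Sum>k<N. ?D h $$ (i, k) * ?J $$ (k, j))"
      using ij by (simp add: times_mat_def scalar_prod_def lessThan_atLeast0)
    also have "\<dots> = (\<Sum>k\<in>{i}. ?D h $$ (i, k) * ?J $$ (k, j))"
      using ij by (intro sum.mono_neutral_right) auto
    finally show "(?D h * ?J) $$ (i, j) = mat N N (\<lambda>(i, j). if j = N - 1 - i then h i else 0) $$ (i, j)"
      using ij by auto
  qed simp_all
  have DD: "?D h * ?D h' = ?D (\<lambda>i. h i * h' i)" for h h'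
  proof (rule eq_matI)
    fix i j assume "i < dim_row (?D (\<lambda>i. h i * h' i))" "j < dim_col (?D (\<lambda>i. h i * h' i))"
    then have ij: "i < N" "j < N" by simp_all
    have "(?D h * ?D h') $$ (i, j) = (\<Sum>k<N. ?D h $$ (i, k) * ?D h' $$ (k, j))"
      using ij by (simp add: times_mat_def scalar_prod_def lessThan_atLeast0)
    also have "\<dots> = (\<Sum>k\<in>{i}. ?D h $$ (i, k) * ?D h' $$ (k, j))"
      using ij by (intro sum.mono_neutral_right) auto
    finally show "(?D h * ?D h') $$ (i, j) = ?D (\<lambda>i. h i * h' i) $$ (i, j)"
      using ij by auto
  qed simp_all
  have JD: "?J * mat N N (\<lambda>(i, j). p i j) = mat N N (\<lambda>(i, j). p (N - 1 - i) j)" for p :: "nat \<Rightarrow> nat \<Rightarrow> 'a"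
  proof (rule eq_matI)
    fix i j assume "i < dim_row (mat N N (\<lambda>(i, j). p (N - 1 - i) j))"
      "j < dim_col (mat N N (\<lambda>(i, j). p (N - 1 - i) j))"
    then have ij: "i < N" "j < N" by simp_all
    have "(?J * mat N N (\<lambda>(i, j). p i j)) $$ (i, j) = (\<Sum>k<N. ?J $$ (i, k) * p k j)"
      using ij by (simp add: times_mat_def scalar_prod_def lessThan_atLeast0)
    also have "\<dots> = (\<Sum>k\<in>{N - 1 - i}. ?J $$ (i, k) * p k j)"
      using ij by (intro sum.mono_neutral_right) auto
    finally show "(?J * mat N N (\<lambda>(i, j). p i j)) $$ (i, j) = mat N N (\<lambda>(i, j). p (N - 1 - i) j) $$ (i, j)"
      using ij by auto
  qed simp_all
  have PX: "?P * ?X = four_block_mat (?D f) (?D g) (?J * ?D (\<lambda>i. g (?r i))) (?J * ?D (\<lambda>i. f (?r i)))"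
    by (subst mult_four_block_mat[of _ N N _ N _ N _ _ N _ N]) auto
  have PXP: "?P * ?X * ?P = four_block_mat (?D f) (?D g * ?J) (?J * ?D (\<lambda>i. g (?r i)))
      (?J * ?D (\<lambda>i. f (?r i)) * ?J)"
    unfolding PX by (subst mult_four_block_mat[of _ N N _ N _ N _ _ N _ N]) auto
  have J: "?J \<in> carrier_mat N N" and D: "?D h \<in> carrier_mat N N" for h by simp_all
  \<comment> \<open>Conjugation by the reversal restores the natural order of the lower half, where
    the entry at position \<open>i\<close> is \<open>h (N + i)\<close>.\<close>
  have JDJ: "?J * ?D (\<lambda>i. h (?r i)) * ?J = ?D (\<lambda>i. h (N + i))" for h
  proof -
    have "?J * ?D (\<lambda>i. h (?r i)) * ?J =
        mat N N (\<lambda>(i, j). if j = N - 1 - (N - 1 - i) then h (?r (N - 1 - i)) else 0)"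
      unfolding assoc_mult_mat[OF J D J] DJ by (rule JD)
    also have "\<dots> = ?D (\<lambda>i. h (N + i))"
    proof (rule eq_matI)
      fix i j assume "i < dim_row (?D (\<lambda>i. h (N + i)))" "j < dim_col (?D (\<lambda>i. h (N + i)))"
      then have "i < N" "j < N" "?r (N - 1 - i) = N + i" "N - 1 - (N - 1 - i) = i" by simp_all
      then show "mat N N (\<lambda>(i, j). if j = N - 1 - (N - 1 - i) then h (?r (N - 1 - i)) else 0) $$ (i, j) =
          ?D (\<lambda>i. h (N + i)) $$ (i, j)" by (simp only: index_mat prod.case)
    qed simp_all
    finally show ?thesis .
  qed
  have JDr: "?J * ?D (\<lambda>i. h (?r i)) = mat N N (\<lambda>(i, j). if j = N - 1 - i then h (N + i) else 0)" for h
  proof -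
    have "?J * ?D (\<lambda>i. h (?r i)) =
        mat N N (\<lambda>(i, j). if j = N - 1 - i then h (?r (N - 1 - i)) else 0)"
      by (rule JD)
    also have "\<dots> = mat N N (\<lambda>(i, j). if j = N - 1 - i then h (N + i) else 0)"
    proof (rule eq_matI)
      fix i j assume "i < dim_row (mat N N (\<lambda>(i, j). if j = N - 1 - i then h (N + i) else 0))"
        "j < dim_col (mat N N (\<lambda>(i, j). if j = N - 1 - i then h (N + i) else 0))"
      then have "i < N" "j < N" "?r (N - 1 - i) = N + i" by simp_all
      then show "mat N N (\<lambda>(i, j). if j = N - 1 - i then h (?r (N - 1 - i)) else 0) $$ (i, j) =
          mat N N (\<lambda>(i, j). if j = N - 1 - i then h (N + i) else 0) $$ (i, j)"
        by (simp only: index_mat prod.case)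
    qed simp_all
    finally show ?thesis .
  qed
  have X: "?P * ?X * ?P = cross N f g"
    unfolding PXP DJ[of g] JDJ[of f] JDr[of g]
  proof (rule eq_matI)
    fix i j assume "i < dim_row (cross N f g)" "j < dim_col (cross N f g)"
    then have ij: "i < 2 * N" "j < 2 * N" by simp_all
    have "j \<noteq> 2 * N - 1 - i" if "i < N \<longleftrightarrow> j < N" using that ij by auto
    moreover have "j - N = i - N \<longleftrightarrow> j = i" "N + (i - N) = i" if "N \<le> i" "N \<le> j" using that by auto
    moreover have "j - N = N - 1 - i \<longleftrightarrow> j = 2 * N - 1 - i" if "i < N" "N \<le> j" using that ij by auto
    moreover have "j = N - 1 - (i - N) \<longleftrightarrow> j = 2 * N - 1 - i" if "j < N" "N \<le> i" using that ij by auto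
    ultimately show "four_block_mat (?D f) (mat N N (\<lambda>(i, j). if j = N - 1 - i then g i else 0))
        (mat N N (\<lambda>(i, j). if j = N - 1 - i then g (N + i) else 0)) (?D (\<lambda>i. f (N + i))) $$ (i, j) =
        cross N f g $$ (i, j)"
      using ij by (cases "i < N"; cases "j < N") (simp_all add: cross_index del: One_nat_def diff_diff_left)
  qed simp_all
  have "det (cross N f g) = det ?J * det ?X * det ?J"
  proof -
    have cP: "?P \<in> carrier_mat (N + N) (N + N)" and cX: "?X \<in> carrier_mat (N + N) (N + N)"
      by (intro four_block_carrier_mat; simp)+
    show ?thesis
      unfolding X[symmetric] P[symmetric] det_mult[OF mult_carrier_mat[OF cP cX] cP] det_mult[OF cP cX] ..
  qed
  \<comment> \<open>The determinant of the reversal occurs twice, so its sign drops out.\<close>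
  also have "\<dots> = det (?J * ?J) * det ?X"
    by (simp add: det_mult[of _ N])
  also have "\<dots> = det ?X" unfolding JJ by simp
  also have "\<dots> = det (?D f * ?D (\<lambda>i. f (?r i)) - ?D g * ?D (\<lambda>i. g (?r i)))"
  proof (rule det_four_block_mat[of _ N])
    show "?D (\<lambda>i. g (?r i)) * ?D (\<lambda>i. f (?r i)) = ?D (\<lambda>i. f (?r i)) * ?D (\<lambda>i. g (?r i))"
      unfolding DD by (rule arg_cong[of _ _ ?D]) (rule ext, rule mult.commute)
  qed simp_all
  also have "\<dots> = det (?D (\<lambda>i. f i * f (?r i) - g i * g (?r i)))"
    unfolding DD by (rule arg_cong[of _ _ det], rule eq_matI) auto
  finally show ?thesis by (simp add: det_diag)
qed

text \<open>Pulling \<open>C\<close> out of the lower row leaves the blocks \<open>1\<close> and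
  \<open>Y\<close>, which commute, so the block determinant formula applies even where
  \<open>C\<close> and \<open>C * Y\<close> do not commute. In the application \<open>C\<close> and
  \<open>C * Y\<close> are the Fox blocks of the second relator.\<close>

lemma det_four_block_mat_lower_left_factor:
  fixes A :: "'a::idom mat"
  assumes [simp]: "A \<in> carrier_mat n n" "B \<in> carrier_mat n n" "C \<in> carrier_mat n n" "Y \<in> carrier_mat n n"
  shows "det (four_block_mat A B C (C * Y)) = det C * det (A * Y - B)"
proof -
  let ?P = "four_block_mat (1\<^sub>m n) (0\<^sub>m n n) (0\<^sub>m n n) C"
  have "0\<^sub>m n n + C * Y = C * Y"
    by (rule left_add_zero_mat[OF mult_carrier_mat[of C n n Y n]]) simp_all
  then have "?P * four_block_mat A B (1\<^sub>m n) Y = four_block_mat A B C (C * Y)"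
    by (subst mult_four_block_mat[of _ n n _ n _ n _ _ n _ n])
      (simp_all add: left_mult_one_mat[of _ n n] right_mult_one_mat[of _ n n] left_mult_zero_mat[of _ n n])
  then have "det (four_block_mat A B C (C * Y)) = det ?P * det (four_block_mat A B (1\<^sub>m n) Y)"
    using det_mult[of ?P "n + n" "four_block_mat A B (1\<^sub>m n) Y"] by simp
  also have "det ?P = det C"
    by (subst det_four_block_mat_upper_right_zero[of _ n _ n]) auto
  also have "det (four_block_mat A B (1\<^sub>m n) Y) = det (A * Y - B * 1\<^sub>m n)"
    by (rule det_four_block_mat[of _ n]) (simp_all add: left_mult_one_mat[of Y n n] right_mult_one_mat[of Y n n])
  finally show ?thesis by (simp add: right_mult_one_mat[of B n n])
qed

section \<open>Symmetric powers of monomial matrices\<close>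

lemma poly2_subst_monom: "poly2_subst (monom (monom 1 p) j) x' y' = x' ^ p * y' ^ j"
proof -
  have "poly2_subst (monom (monom 1 p) j) x' y' =
      (\<Sum>k\<in>{j}. \<Sum>i\<le>degree (coeff (monom (monom (1::complex) p) j) k).
        [:[:coeff (coeff (monom (monom 1 p) j) k) i:]:] * x' ^ i * y' ^ k)"
    unfolding poly2_subst_def by (rule sum.mono_neutral_right) (auto simp: degree_monom_eq)
  also have "\<dots> = (\<Sum>i\<le>degree (coeff (monom (monom (1::complex) p) j) j).
      [:[:coeff (coeff (monom (monom 1 p) j) j) i:]:] * x' ^ i * y' ^ j)"
    by simp
  also have "\<dots> = (\<Sum>i\<in>{p}. [:[:coeff (coeff (monom (monom 1 p) j) j) i:]:] * x' ^ i * y' ^ j)"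
    by (rule sum.mono_neutral_right) (auto simp: degree_monom_eq)
  finally show ?thesis by (simp add: one_pCons[symmetric])
qed

text \<open>The action uses the inverse matrix, so x goes to x/z and y to z y, and the monomial of
  y-degree k is scaled by z^(k - (d - 1 - k)).\<close>

lemma sym_rep_dmat:
  assumes "z \<noteq> 0"
  shows "sym_rep d (dmat z) = mat d d (\<lambda>(k, j). if j = k then z powi (2 * int k - int d + 1) else 0)"
proof (rule eq_matI)
  fix k j assume "k < dim_row (mat d d (\<lambda>(k, j). if j = k then z powi (2 * int k - int d + 1) else 0))"
    "j < dim_col (mat d d (\<lambda>(k, j). if j = k then z powi (2 * int k - int d + 1) else 0))"
  then have kj: "k < d" "j < d" by auto
  have B: "(inv\<^bsub>SL 2\<^esub> dmat z) $$ (0, 0) = inverse z" "(inv\<^bsub>SL 2\<^esub> dmat z) $$ (0, 1) = 0"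
    "(inv\<^bsub>SL 2\<^esub> dmat z) $$ (1, 0) = 0" "(inv\<^bsub>SL 2\<^esub> dmat z) $$ (1, 1) = z"
    unfolding dmat_inv[OF assms] by (simp_all add: dmat_def mat_of_rows_list_def)
  have x': "[:[:0, inverse z:], [:0:]:] = monom (monom (inverse z) 1) 0"
    and y': "[:[:0, 0:], [:z:]:] = monom (monom z 0) 1"
    by (simp_all add: monom_0 monom_Suc)
  have "SL2_act (dmat z) (monom (monom 1 (d - 1 - j)) j) =
      monom (monom (inverse z ^ (d - 1 - j) * z ^ j) (d - 1 - j)) j"
    unfolding SL2_act_def Let_def B poly2_subst_monom x' y'
    by (simp only: monom_power mult_monom) simp
  moreover have "inverse z ^ (d - 1 - j) * z ^ j = z powi (2 * int j - int d + 1)"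
  proof -
    have e: "2 * int j - int d + 1 = int j - int (d - 1 - j)" using kj by simp
    show ?thesis unfolding e using assms
      by (simp add: power_int_diff power_inverse divide_inverse)
  qed
  ultimately show "sym_rep d (dmat z) $$ (k, j) =
      mat d d (\<lambda>(k, j). if j = k then z powi (2 * int k - int d + 1) else 0) $$ (k, j)"
    using kj by (auto simp: sym_rep_def)
qed (auto simp: sym_rep_def)

text \<open>Here x goes to -z y and y to x/z, so y-degree j becomes k = d - 1 - j; the sign comes
  from the k factors -z.\<close>

lemma sym_rep_emat:
  assumes "z \<noteq> 0" "even d"
  shows "sym_rep d (emat z) =
    mat d d (\<lambda>(k, j). if j = d - 1 - k then (- 1) ^ k * z powi (2 * int k - int d + 1) else 0)"
proof (rule eq_matI)
  fix k j assume "k < dim_row (mat d d (\<lambda>(k, j). if j = d - 1 - k then (- 1) ^ k * z powi (2 * int k - int d + 1) else 0))"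
    "j < dim_col (mat d d (\<lambda>(k, j). if j = d - 1 - k then (- 1) ^ k * z powi (2 * int k - int d + 1) else 0))"
  then have kj: "k < d" "j < d" by auto
  have B: "(inv\<^bsub>SL 2\<^esub> emat z) $$ (0, 0) = 0" "(inv\<^bsub>SL 2\<^esub> emat z) $$ (0, 1) = - z"
    "(inv\<^bsub>SL 2\<^esub> emat z) $$ (1, 0) = inverse z" "(inv\<^bsub>SL 2\<^esub> emat z) $$ (1, 1) = 0"
    unfolding emat_inv[OF assms(1)] by (simp_all add: emat_def mat_of_rows_list_def)
  have x': "[:[:0, 0:], [:- z:]:] = monom (monom (- z) 0) 1"
    and y': "[:[:0, inverse z:], [:0:]:] = monom (monom (inverse z) 1) 0"
    by (simp_all add: monom_0 monom_Suc)
  have act: "SL2_act (emat z) (monom (monom 1 (d - 1 - j)) j) =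
      monom (monom ((- z) ^ (d - 1 - j) * inverse z ^ j) j) (d - 1 - j)"
    unfolding SL2_act_def Let_def B poly2_subst_monom x' y'
    by (simp only: monom_power mult_monom) simp
  have "(- z) ^ k * inverse z ^ j = (- 1) ^ k * z powi (2 * int k - int d + 1)" if "j = d - 1 - k"
  proof -
    have e: "2 * int k - int d + 1 = int k - int j" using kj that by simp
    show ?thesis unfolding e using assms
      by (simp add: power_int_diff power_inverse divide_inverse power_minus[of z])
  qed
  moreover have "d - 1 - j = k \<longleftrightarrow> j = d - 1 - k" using kj by auto
  moreover have "d - 1 - k = j" if "j = d - 1 - k" using that ..
  moreover have "sym_rep d (emat z) $$ (k, j) = (if d - 1 - j = k then (- z) ^ (d - 1 - j) * inverse z ^ j else 0)"
  proof -
    have "sym_rep d (emat z) $$ (k, j) =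
        coeff (coeff (SL2_act (emat z) (monom (monom 1 (d - 1 - j)) j)) k) (d - 1 - k)"
      using kj by (simp add: sym_rep_def)
    then show ?thesis unfolding act using kj by auto
  qed
  ultimately show "sym_rep d (emat z) $$ (k, j) =
      mat d d (\<lambda>(k, j). if j = d - 1 - k then (- 1) ^ k * z powi (2 * int k - int d + 1) else 0) $$ (k, j)"
    using kj by (simp del: diff_diff_left)
qed (auto simp: sym_rep_def)

section \<open>Fox blocks of the double twist knot\<close>

text \<open>The product rule D(vw) = D(v) + v D(w), with left multiplication by v expressed as an
  extension of the prefix.\<close>

lemma fox_at_append: "fox_at f x u (v @ w) = fox_at f x u v + fox_at f x (u @ v) w"
proof (induction f x u v rule: fox_at.induct)
  case (2 f x u y v)
  then show ?case by (simp add: gen_def)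
next
  case (3 f x u y v)
  then show ?case by (simp add: gen_inv_def)
qed simp

lemma fox_at_gen: "fox_at f x u (gen y) = (if y = x then f u else 0)"
  by (simp add: gen_def)

lemma fox_at_gen_inv: "fox_at f x u (gen_inv y) = - (if y = x then f (u @ gen_inv y) else 0)"
  by (simp add: gen_inv_def)

lemma fox_at_word_pow_gen:
  "fox_at f x u (word_pow (gen y) k) = (if y = x then \<Sum>l<k. f (u @ word_pow (gen y) l) else 0)"
proof (induction k arbitrary: u)
  case (Suc k)
  show ?case
    unfolding word_pow_Suc fox_at_append Suc fox_at_gen
    by (simp add: sum.lessThan_Suc_shift word_pow_0 word_pow_Suc del: sum.lessThan_Suc)
qed (simp add: word_pow_0)

text \<open>The derivative of y^-1 is -y^-1 and not -1, so the sum runs over y^-1, ..., y^-k; hence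
  \<open>Suc l\<close>.\<close>

lemma fox_at_word_pow_gen_inv:
  "fox_at f x u (word_pow (gen_inv y) k) =
    (if y = x then - (\<Sum>l<k. f (u @ word_pow (gen_inv y) (Suc l))) else 0)"
proof (induction k arbitrary: u)
  case (Suc k)
  show ?case
    unfolding word_pow_Suc fox_at_append Suc fox_at_gen_inv
    by (simp add: sum.lessThan_Suc_shift word_pow_0 word_pow_Suc del: sum.lessThan_Suc)
qed (simp add: word_pow_0)

text \<open>Allows \<open>lin_ext_fox\<close> to start from the empty prefix. Multiplication by the
  unit class can enlarge an arbitrary set of words, but only by words that the projection adds
  anyway.\<close>

lemma pres_proj_one_mult: "pres_proj R (word_class {} [] \<otimes>\<^bsub>free_group\<^esub> A) = pres_proj R A"
proof (rule equalityI; rule subsetI)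
  fix w assume "w \<in> pres_proj R (word_class {} [] \<otimes>\<^bsub>free_group\<^esub> A)"
  then obtain u v x where uvx: "pres_eq {} [] u" "v \<in> A" "pres_eq {} (u @ v) x" "pres_eq R x w"
    by (auto simp: pres_proj_def pres_group_def word_class_def)
  have "pres_eq R ([] @ v) (u @ v)"
    by (rule pres_eq_append2[OF pres_eq_mono[OF uvx(1)] pres_eq.refl]) simp
  moreover have "pres_eq R (u @ v) x" by (rule pres_eq_mono[OF uvx(3)]) simp
  ultimately have "pres_eq R v w" using uvx(4) by (auto intro: pres_eq.trans)
  then show "w \<in> pres_proj R A" using uvx(2) by (auto simp: pres_proj_def)
next
  fix w assume "w \<in> pres_proj R A"
  then obtain v where v: "v \<in> A" "pres_eq R v w" by (auto simp: pres_proj_def)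
  have "v \<in> word_class {} [] \<otimes>\<^bsub>free_group\<^esub> A"
    using v(1) pres_eq.refl[of "{}" "[]"] pres_eq.refl[of "{}" v]
    by (force simp: pres_group_def word_class_def)
  then show "w \<in> pres_proj R (word_class {} [] \<otimes>\<^bsub>free_group\<^esub> A)"
    using v(2) by (auto simp: pres_proj_def)
qed

lemma fox_block_index:
  assumes "i < d" "j < d"
  shows "fox_block m n d \<phi> r x $$ (i, j) =
    fox_at (\<lambda>w. \<phi> (word_class (twist_rels m n) w) $$ (i, j)) x [] r"
  using lin_ext_fox[of "\<lambda>A. \<phi> A $$ (i, j)" "twist_rels m n" "[]" x r] assms
  by (simp add: fox_block_def gr_lin_ext_index lin_ext_gr_map pres_proj_one_mult)

lemma fox_at_rel1:
  "fox_at f X1 [] (rel1 m) = (\<Sum>l<m. f (gen Mu @ word_pow (gen X1) l))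
    - (\<Sum>l<m. f (gen Mu @ word_pow (gen X1) m @ gen_inv Mu @ gen X2 @ word_pow (gen_inv X1) (Suc l)))"
  "fox_at f X2 [] (rel1 m) = f (gen Mu @ word_pow (gen X1) m @ gen_inv Mu)"
  by (simp_all add: rel1_def fox_at_append fox_at_gen fox_at_gen_inv fox_at_word_pow_gen
      fox_at_word_pow_gen_inv)

lemma fox_at_rel2:
  "fox_at f X1 [] (rel2 n) = f (gen Mu @ word_pow (gen_inv X2) n)"
  "fox_at f X2 [] (rel2 n) = (\<Sum>l<n. f (gen Mu @ word_pow (gen_inv X2) n @ gen X1 @ gen_inv Mu
      @ word_pow (gen X2) l)) - (\<Sum>l<n. f (gen Mu @ word_pow (gen_inv X2) (Suc l)))"
  by (simp_all add: rel2_def fox_at_append fox_at_gen fox_at_gen_inv fox_at_word_pow_gen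
      fox_at_word_pow_gen_inv)

text \<open>Here \<open>a\<close> stands for \<xi>^i. Its being a root of unity enters through
  \<open>a_pow\<close>, in a form that avoids the subtraction in 4mn - 1.\<close>

locale monomial_rep =
  fixes m n :: nat and a :: complex and \<rho> :: "knot_gen word set \<Rightarrow> complex mat"
  assumes hom: "\<rho> \<in> hom (twist_group m n) (SL 2)"
    and X1: "\<rho> (twist_elt m n X1) = dmat a"
    and X2: "\<rho> (twist_elt m n X2) = dmat (a ^ (2 * m))"
    and Mu: "\<rho> (twist_elt m n Mu) = emat 1"
    and a_pow: "a ^ (4 * m * n) = a" and a0: "a \<noteq> 0"
begin

section \<open>Values of the representation on words\<close>

abbreviation "ev w \<equiv> \<rho> (word_class (twist_rels m n) w)"

lemma ev_append: "ev (u @ v) = ev u * ev v"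
  using hom by (simp add: hom_def word_class_mult[symmetric] pres_group_carrier)

sublocale H: group_hom "twist_group m n" "SL 2" \<rho>
  using hom group_pres_group group_SL by (simp add: group_hom_def group_hom_axioms_def)

lemma ev_nil: "ev [] = dmat 1"
  using H.hom_one by (simp add: word_class_one SL_one dmat_1)

lemma ev_gen: "ev (gen X1) = dmat a" "ev (gen X2) = dmat (a ^ (2 * m))" "ev (gen Mu) = emat 1"
  using X1 X2 Mu by (simp_all add: twist_elt_def)

lemma ev_gen_inv: "ev (gen_inv x) = inv\<^bsub>SL 2\<^esub> ev (gen x)"
proof -
  have "word_class (twist_rels m n) (gen_inv x) \<otimes>\<^bsub>twist_group m n\<^esub> word_class (twist_rels m n) (gen x)
      = \<one>\<^bsub>twist_group m n\<^esub>"
    using pres_eq.cancel[of "twist_rels m n" "[]" x True "[]"]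
    by (simp add: word_class_mult word_class_one word_class_eq_iff gen_def gen_inv_def)
  then have "word_class (twist_rels m n) (gen_inv x) = inv\<^bsub>twist_group m n\<^esub> word_class (twist_rels m n) (gen x)"
    by (intro H.G.inv_equality[symmetric]) (simp_all add: pres_group_carrier)
  then show ?thesis by (simp add: pres_group_carrier)
qed

text \<open>Integer exponents reduce the evaluation of a word to adding exponents, with a change of
  sign behind an antidiagonal factor. \<open>en\<close> occurs because the inverse of
  \<open>ep p\<close> is \<open>en p\<close>.\<close>

definition dp :: "int \<Rightarrow> complex mat" where "dp p = dmat (a powi p)"
definition ep :: "int \<Rightarrow> complex mat" where "ep p = emat (a powi p)"
definition en :: "int \<Rightarrow> complex mat" where "en p = emat (- (a powi p))"

lemma dp_ep_mult:
  "dp p * dp q = dp (p + q)" "dp p * ep q = ep (p + q)" "ep p * dp q = ep (p - q)"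
  "en p * dp q = en (p - q)" "dp p * en q = en (p + q)" "ep p * en q = dp (p - q)"
  using a0 by (simp_all add: dp_def ep_def en_def dmat_mult power_int_add power_int_diff divide_inverse)

lemma ev_letter:
  "ev (gen X1) = dp 1" "ev (gen X2) = dp (2 * int m)" "ev (gen Mu) = ep 0"
  "ev (gen_inv X1) = dp (- 1)" "ev (gen_inv X2) = dp (- 2 * int m)" "ev (gen_inv Mu) = en 0"
proof -
  have "a ^ (2 * m) = a powi (2 * int m)" by (simp flip: power_int_of_nat)
  then show "ev (gen X1) = dp 1" "ev (gen X2) = dp (2 * int m)" "ev (gen Mu) = ep 0"
    "ev (gen_inv X1) = dp (- 1)" "ev (gen_inv X2) = dp (- 2 * int m)" "ev (gen_inv Mu) = en 0"
    using a0 by (simp_all add: ev_gen_inv ev_gen dmat_inv emat_inv dp_def ep_def en_def power_int_minus)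
qed

lemma ev_word_pow: "ev w = dp p \<Longrightarrow> ev (word_pow w k) = dp (int k * p)"
  by (induction k)
    (simp_all add: word_pow_0 word_pow_Suc ev_nil ev_append dp_ep_mult algebra_simps, simp add: dp_def)

lemmas ev_simps = ev_append ev_letter ev_word_pow[OF ev_letter(1)] ev_word_pow[OF ev_letter(2)]
  ev_word_pow[OF ev_letter(4)] ev_word_pow[OF ev_letter(5)] dp_ep_mult

text \<open>The eigenvalue of \<open>x\<^sub>1\<close> on the basis vector with index \<open>k\<close>.\<close>

definition weight :: "nat \<Rightarrow> nat \<Rightarrow> complex" where
  "weight N k = a powi (2 * int k - int (2 * N) + 1)"

abbreviation geo :: "nat \<Rightarrow> complex \<Rightarrow> complex" where
  "geo k z \<equiv> \<Sum>l<k. z ^ l"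

lemma powi_swap: "(a powi p) powi e = (a powi e) powi p"
  by (simp add: power_int_mult[symmetric] mult.commute)

lemma sym_dp: "sym_rep (2 * N) (dp p) = cross N (\<lambda>k. weight N k powi p) (\<lambda>_. 0)"
  using a0 unfolding dp_def cross_def weight_def
  by (subst sym_rep_dmat) (simp_all only: powi_swap[of p] power_int_eq_0_iff if_cancel simp_thms)

lemma sym_ep: "sym_rep (2 * N) (ep p) = cross N (\<lambda>_. 0) (\<lambda>k. (- 1) ^ k * weight N k powi p)"
proof (rule eq_matI)
  fix i j assume "i < dim_row (cross N (\<lambda>_. 0) (\<lambda>k. (- 1) ^ k * weight N k powi p))"
    "j < dim_col (cross N (\<lambda>_. 0) (\<lambda>k. (- 1) ^ k * weight N k powi p))"
  then have ij: "i < 2 * N" "j < 2 * N" by simp_all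
  have a: "a powi p \<noteq> 0" using a0 by simp
  show "sym_rep (2 * N) (ep p) $$ (i, j) = cross N (\<lambda>_. 0) (\<lambda>k. (- 1) ^ k * weight N k powi p) $$ (i, j)"
    unfolding ep_def sym_rep_emat[OF a, of "2 * N", OF dvd_triv_left]
    using ij reflect_neq[OF ij(1)] by (auto simp: cross_index weight_def powi_swap[of p])
qed (simp_all add: sym_rep_def)

text \<open>The exponent 2k - 2N + 1 changes sign when k is replaced by 2N - 1 - k, so mirror
  indices carry inverse eigenvalues.\<close>

lemma weight_rev: "k < 2 * N \<Longrightarrow> weight N (2 * N - Suc k) = inverse (weight N k)"
  by (simp add: weight_def power_int_minus[symmetric] of_nat_diff algebra_simps)

lemma weight_pow: "weight N k ^ (4 * m * n) = weight N k"
proof -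
  let ?e = "2 * int k - int (2 * N) + 1"
  have "weight N k ^ (4 * m * n) = (a powi ?e) powi int (4 * m * n)"
    unfolding weight_def by (simp only: power_int_of_nat)
  also have "\<dots> = (a powi int (4 * m * n)) powi ?e"
    by (simp only: power_int_mult[symmetric] mult.commute)
  also have "\<dots> = weight N k" by (simp only: power_int_of_nat a_pow weight_def)
  finally show ?thesis .
qed

lemma weight_ne0: "weight N k \<noteq> 0" using a0 by (simp add: weight_def)

lemma powi_forms:
  fixes z :: complex
  shows
  "z powi (- int l) = inverse z ^ l"
  "z powi (int k * (2 * int l)) = (z ^ (2 * l)) ^ k"
  "z powi ((1 + int k) * (2 * int l)) = z ^ (2 * l) * (z ^ (2 * l)) ^ k"
proof -
  show "z powi (- int l) = inverse z ^ l" by (simp add: power_int_minus power_inverse)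
  have 1: "z powi (int k * (2 * int l)) = (z ^ (2 * l)) ^ k" for k
  proof -
    have "int k * (2 * int l) = int (2 * l * k)" by simp
    then show ?thesis by (simp only: power_int_of_nat power_mult)
  qed
  show "z powi (int k * (2 * int l)) = (z ^ (2 * l)) ^ k" by (rule 1)
  show "z powi ((1 + int k) * (2 * int l)) = z ^ (2 * l) * (z ^ (2 * l)) ^ k"
    using 1[of "Suc k"] by simp
qed

text \<open>Needed for the words \<mu> x1^m \<mu>^-1 x2 x1^-(l+1) of the first relator: conjugation
  by \<mu> inverts x1, and x2 acts as x1^(2m), so they act as x1^(m-l-1), with exponents running
  down from m - 1 to 0.\<close>

lemma geo_rev: "(\<Sum>l<k. z powi (int k - (int l + 1))) = geo k z"
proof -
  have "(\<Sum>l<k. z powi (int k - (int l + 1))) = (\<Sum>l<k. z ^ (k - Suc l))"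
  proof (rule sum.cong[OF HOL.refl])
    fix l assume "l \<in> {..<k}"
    then have "int k - (int l + 1) = int (k - Suc l)" by simp
    then show "z powi (int k - (int l + 1)) = z ^ (k - Suc l)" by (simp only: power_int_of_nat)
  qed
  also have "\<dots> = geo k z" by (rule sum.nat_diff_reindex)
  finally show ?thesis .
qed

section \<open>The four Fox blocks as cross matrices\<close>

lemma fox_block_cross:
  assumes "\<And>i j. i < 2 * N \<Longrightarrow> j < 2 * N \<Longrightarrow>
    fox_at (\<lambda>w. sym_rep (2 * N) (ev w) $$ (i, j)) x [] r = cross N f g $$ (i, j)"
  shows "fox_block m n (2 * N) (sym_rep (2 * N) \<circ> \<rho>) r x = cross N f g"
  by (rule eq_matI) (simp_all add: assms fox_block_index, simp_all add: fox_block_def gr_lin_ext_def)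

text \<open>The antidiagonal comes from the words \<mu> x1^l, the diagonal from the subtracted
  words, which contain both \<mu> and its inverse.\<close>

lemma fox_block_rel1_X1:
  "fox_block m n (2 * N) (sym_rep (2 * N) \<circ> \<rho>) (rel1 m) X1 =
    cross N (\<lambda>k. - geo m (weight N k)) (\<lambda>k. (- 1) ^ k * geo m (inverse (weight N k)))"
proof (rule fox_block_cross)
  fix i j assume ij: "i < 2 * N" "j < 2 * N"
  show "fox_at (\<lambda>w. sym_rep (2 * N) (ev w) $$ (i, j)) X1 [] (rel1 m) =
    cross N (\<lambda>k. - geo m (weight N k)) (\<lambda>k. (- 1) ^ k * geo m (inverse (weight N k))) $$ (i, j)"
    using ij
    by (cases "j = i"; cases "j = 2 * N - Suc i")
      (simp_all add: fox_at_rel1 ev_simps sym_dp sym_ep cross_index reflect_neq geo_rev sum_negf powi_forms sum_distrib_left)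
qed

lemma fox_block_rel1_X2:
  "fox_block m n (2 * N) (sym_rep (2 * N) \<circ> \<rho>) (rel1 m) X2 =
    cross N (\<lambda>k. inverse (weight N k) ^ m) (\<lambda>_. 0)"
proof (rule fox_block_cross)
  fix i j assume ij: "i < 2 * N" "j < 2 * N"
  show "fox_at (\<lambda>w. sym_rep (2 * N) (ev w) $$ (i, j)) X2 [] (rel1 m) =
    cross N (\<lambda>k. inverse (weight N k) ^ m) (\<lambda>_. 0) $$ (i, j)"
    using ij
    by (cases "j = i"; cases "j = 2 * N - Suc i")
      (simp_all add: fox_at_rel1 ev_simps sym_dp sym_ep cross_index reflect_neq geo_rev sum_negf powi_forms sum_distrib_left)
qed

lemma fox_block_rel2_X1:
  "fox_block m n (2 * N) (sym_rep (2 * N) \<circ> \<rho>) (rel2 n) X1 =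
    cross N (\<lambda>_. 0) (\<lambda>k. (- 1) ^ k * (weight N k ^ (2 * m)) ^ n)"
proof (rule fox_block_cross)
  fix i j assume ij: "i < 2 * N" "j < 2 * N"
  show "fox_at (\<lambda>w. sym_rep (2 * N) (ev w) $$ (i, j)) X1 [] (rel2 n) =
    cross N (\<lambda>_. 0) (\<lambda>k. (- 1) ^ k * (weight N k ^ (2 * m)) ^ n) $$ (i, j)"
    using ij
    by (cases "j = i"; cases "j = 2 * N - Suc i")
      (simp_all add: fox_at_rel2 ev_simps sym_dp sym_ep cross_index reflect_neq geo_rev sum_negf powi_forms sum_distrib_left)
qed

lemma fox_block_rel2_X2:
  "fox_block m n (2 * N) (sym_rep (2 * N) \<circ> \<rho>) (rel2 n) X2 =
    cross N (\<lambda>k. inverse (weight N k ^ (2 * m)) ^ n * geo n (weight N k ^ (2 * m)))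
      (\<lambda>k. - ((- 1) ^ k * (weight N k ^ (2 * m) * geo n (weight N k ^ (2 * m)))))"
proof (rule fox_block_cross)
  fix i j assume ij: "i < 2 * N" "j < 2 * N"
  \<comment> \<open>The word \<mu> x2^-n x1 \<mu>^-1 x2^l has exponent 2mn - 1 + 2ml. Writing w =
    z^(2m), the relation z^(4mn) = z says z = w^(2n), so z^(2mn-1) becomes w^-n.\<close>
  have e: "weight N k powi (int n * (2 * int m) - (1 - int l * (2 * int m))) =
      inverse (weight N k ^ (2 * m)) ^ n * (weight N k ^ (2 * m)) ^ l" for k l
  proof -
    define w where "w = weight N k ^ (2 * m)"
    have "w ^ n * w ^ n = weight N k ^ (4 * m * n)"
      by (simp add: w_def power_mult[symmetric] power_add[symmetric] mult.assoc)
    then have w: "w ^ n \<noteq> 0" "weight N k = w ^ n * w ^ n"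
      using weight_ne0[of N k] by (simp_all add: weight_pow w_def)
    have "weight N k powi (int n * (2 * int m) - (1 - int l * (2 * int m))) = w ^ n / (weight N k / w ^ l)"
      using weight_ne0[of N k] by (simp add: power_int_diff powi_forms w_def)
    also have "\<dots> = inverse w ^ n * w ^ l"
      using w by (simp add: field_simps)
    finally show ?thesis by (simp add: w_def)
  qed
  show "fox_at (\<lambda>w. sym_rep (2 * N) (ev w) $$ (i, j)) X2 [] (rel2 n) =
    cross N (\<lambda>k. inverse (weight N k ^ (2 * m)) ^ n * geo n (weight N k ^ (2 * m)))
      (\<lambda>k. - ((- 1) ^ k * (weight N k ^ (2 * m) * geo n (weight N k ^ (2 * m))))) $$ (i, j)"
    using ij e
    by (cases "j = i"; cases "j = 2 * N - Suc i")
      (simp_all add: fox_at_rel2 ev_simps sym_dp sym_ep cross_index reflect_neq geo_rev sum_negf powi_forms sum_distrib_left)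
qed

end

section \<open>The torsion as a product\<close>

text \<open>The contribution of the mirror weights z and 1/z to the determinant of the Schur
  complement. Geometric sums instead of quotients keep z = 1 meaningful.\<close>

definition pairdet :: "nat \<Rightarrow> nat \<Rightarrow> complex \<Rightarrow> complex" where
  "pairdet m n z = (let s = \<Sum>l<m. z ^ l; s' = \<Sum>l<m. inverse z ^ l;
      t = \<Sum>l<n. (z ^ (2 * m)) ^ l; t' = \<Sum>l<n. inverse (z ^ (2 * m)) ^ l
    in (s * t + s' * t * inverse z - inverse z ^ m) * (s' * t' + s * t' * z - z ^ m)
      - (s * z - s') * (s - s' * inverse z) * t * t')"

lemma pairdet_1: "pairdet m n 1 = (2 * of_nat m * of_nat n - 1)\<^sup>2"
  by (simp add: pairdet_def Let_def algebra_simps power2_eq_square)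

text \<open>To be applied with Z = z^m and U = z^(2mn), a square root of z. The first product is
  U/(U+1)^2 and the second is the same times ((Z-1)/(Z+1))^2; the difference closes up because
  (Z+1)^2 - (Z-1)^2 = 4Z.\<close>

lemma pairdet_factor:
  fixes U Z :: complex
  assumes "U \<noteq> 0" "Z \<noteq> 0" "U\<^sup>2 \<noteq> 1" "Z\<^sup>2 \<noteq> 1"
    and z: "z = U\<^sup>2"
    and s: "s = (Z - 1) / (U\<^sup>2 - 1)" and s': "s' = (inverse Z - 1) / (inverse (U\<^sup>2) - 1)"
    and t: "t = (U - 1) / (Z\<^sup>2 - 1)" and t': "t' = (inverse U - 1) / (inverse (Z\<^sup>2) - 1)"
  shows "(s * t + s' * t * inverse z - inverse Z) * (s' * t' + s * t' * z - Z)
      - (s * z - s') * (s - s' * inverse z) * t * t' = 4 * s * s' * t * t'"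
proof -
  \<comment> \<open>The linear factors are kept as opaque nonzero symbols for clearing denominators
    and are unfolded only to compare numerators.\<close>
  define A B C D where "A = U - 1" "B = U + 1" "C = Z - 1" "D = Z + 1"
  have ne: "A \<noteq> 0" "B \<noteq> 0" "C \<noteq> 0" "D \<noteq> 0"
    using assms(3,4) by (auto simp: A_B_C_D_def power2_eq_1_iff eq_neg_iff_add_eq_0)
  have U2: "U\<^sup>2 - 1 = A * B" and Z2: "Z\<^sup>2 - 1 = C * D"
    by (simp_all add: A_B_C_D_def power2_eq_square algebra_simps)
  have iU: "inverse (U\<^sup>2) - 1 = - (A * B) / U\<^sup>2" and iZ: "inverse (Z\<^sup>2) - 1 = - (C * D) / Z\<^sup>2"
    using assms(1,2) by (simp_all add: U2[symmetric] Z2[symmetric] field_simps)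
  have S: "s = C / (A * B)" "s' = C * U\<^sup>2 / (Z * (A * B))"
    using assms(1,2) ne unfolding s s' U2 iU by (simp_all add: A_B_C_D_def(3) field_simps)
  have T: "t = A / (C * D)" "t' = A * Z\<^sup>2 / (U * (C * D))"
    using assms(1,2) ne unfolding t t' Z2 iZ by (simp_all add: A_B_C_D_def(1) field_simps)
  have f: "s * t + s' * t * inverse z - inverse Z = - U / (Z * B)"
  proof -
    have h: "s * t + s' * t * inverse z = 1 / (Z * B)"
      using assms(1,2) ne by (simp add: S T z field_simps power2_eq_square) (simp add: A_B_C_D_def algebra_simps)
    show ?thesis unfolding h using assms(2) ne by (simp add: field_simps) (simp add: A_B_C_D_def algebra_simps)
  qed
  have f': "s' * t' + s * t' * z - Z = - Z / B"
  proof -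
    have h: "s' * t' + s * t' * z = U * Z / B"
      using assms(1,2) ne by (simp add: S T z field_simps power2_eq_square) (simp add: A_B_C_D_def algebra_simps)
    show ?thesis unfolding h using ne by (simp add: field_simps) (simp add: A_B_C_D_def algebra_simps)
  qed
  have g: "s * z - s' = C * C * U\<^sup>2 / (Z * A * B)" "s - s' * inverse z = C * C / (Z * A * B)"
    using assms(1,2) ne by (simp_all add: S T z field_simps) (simp_all add: A_B_C_D_def(3) algebra_simps)
  have 1: "- U / (Z * B) * (- Z / B) = U / (B * B)"
    and 2: "C * C * U\<^sup>2 / (Z * A * B) * (C * C / (Z * A * B)) * (A / (C * D)) * (A * Z\<^sup>2 / (U * (C * D))) =
      U / (B * B) * (C * C / (D * D))"
    and 3: "4 * (C / (A * B)) * (C * U\<^sup>2 / (Z * (A * B))) * (A / (C * D)) * (A * Z\<^sup>2 / (U * (C * D))) =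
      U / (B * B) * (4 * Z / (D * D))"
    using assms(1,2) ne by (simp_all add: power2_eq_square mult_ac)
  have "1 - C * C / (D * D) = 4 * Z / (D * D)"
    using ne by (simp add: field_simps) (simp add: A_B_C_D_def algebra_simps)
  then have 4: "U / (B * B) - U / (B * B) * (C * C / (D * D)) = U / (B * B) * (4 * Z / (D * D))"
    by (metis mult.right_neutral right_diff_distrib)
  show ?thesis unfolding f f' g unfolding S T 1 2 3 by (rule 4)
qed

section \<open>Numerator and denominator of the torsion\<close>

context monomial_rep begin

lemma minus_one_power_reflect: "k < 2 * N \<Longrightarrow> (- 1) ^ (2 * N - Suc k) = - ((- 1) ^ k :: complex)"
proof -
  assume "k < 2 * N"
  then have "(- 1) ^ (2 * N - Suc k) * (- 1) ^ Suc k = ((- 1) ^ (2 * N) :: complex)"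
    unfolding power_add[symmetric] by simp
  moreover have "(- 1) ^ Suc k * (- 1) ^ Suc k = (1 :: complex)"
    by (simp add: power_mult_distrib[symmetric])
  ultimately show ?thesis by (auto simp: minus_one_power_iff split: if_splits)
qed

lemma minus_one_sq: "(- 1) ^ k * (- 1) ^ k = (1 :: complex)" "(- 1) ^ k * ((- 1) ^ k * x) = (x :: complex)"
  by (simp_all add: mult.assoc[symmetric] power_mult_distrib[symmetric])

lemma geo_inverse: "w \<noteq> 0 \<Longrightarrow> w ^ k * geo k (inverse w) = w * geo k w"
proof -
  assume "w \<noteq> 0"
  have "w ^ k * geo k (inverse w) = (\<Sum>l<k. w * w ^ (k - Suc l))"
    unfolding sum_distrib_left
  proof (rule sum.cong[OF HOL.refl])
    fix l assume "l \<in> {..<k}"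
    then have "k = Suc (k - Suc l) + l" by simp
    then have "w ^ k = w * w ^ (k - Suc l) * w ^ l" by (metis power_add power_Suc)
    then show "w ^ k * inverse w ^ l = w * w ^ (k - Suc l)"
      using \<open>w \<noteq> 0\<close> by (simp add: power_inverse)
  qed
  also have "\<dots> = w * geo k w"
    unfolding sum_distrib_left[symmetric] by (simp add: sum.nat_diff_reindex)
  finally show ?thesis .
qed

text \<open>The lower left block \<open>?C\<close> is purely antidiagonal with determinant 1, so the
  numerator is the determinant of \<open>?A * ?Y - ?B\<close>, again a cross matrix, to which
  \<open>det_cross\<close> applies.\<close>

lemma torsion_num_eq:
  "torsion_num m n (2 * N) (sym_rep (2 * N) \<circ> \<rho>) = (\<Prod>k<N. pairdet m n (weight N k))"
proof -
  let ?w = "\<lambda>k. weight N k ^ (2 * m)"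
  let ?A = "cross N (\<lambda>k. - geo m (weight N k)) (\<lambda>k. (- 1) ^ k * geo m (inverse (weight N k)))"
  let ?B = "cross N (\<lambda>k. inverse (weight N k) ^ m) (\<lambda>_. 0)"
  let ?C = "cross N (\<lambda>_. 0) (\<lambda>k. (- 1) ^ k * ?w k ^ n)"
  \<comment> \<open>The solution of \<open>?C * ?Y\<close> = lower right block; the antidiagonal
    factor exchanges diagonal and antidiagonal and inverts the weights.\<close>
  let ?Y = "cross N (\<lambda>k. - geo n (?w k)) (\<lambda>k. - ((- 1) ^ k * (weight N k * geo n (inverse (?w k)))))"
  have w0: "?w k \<noteq> 0" for k by (simp add: weight_ne0)
  have ww: "weight N k = ?w k ^ n * ?w k ^ n" for k
    by (subst weight_pow[symmetric]) (simp add: power_mult[symmetric] power_add[symmetric] mult.assoc)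
  have iw: "inverse (weight N k) * ?w k ^ n = inverse (?w k ^ n)" for k
    by (subst ww) (simp add: w0[simplified])
  have rv: "(- 1) ^ (2 * N - 1 - k) = - ((- 1) ^ k :: complex)" "weight N (2 * N - 1 - k) = inverse (weight N k)"
    if "k < 2 * N" for k
    using minus_one_power_reflect[OF that] weight_rev[OF that] by simp_all
  have CY: "?C * ?Y = cross N (\<lambda>k. inverse (?w k) ^ n * geo n (?w k))
      (\<lambda>k. - ((- 1) ^ k * (?w k * geo n (?w k))))"
    unfolding cross_mult
  proof (rule cross_cong)
    fix k assume k: "k < 2 * N"
    have "0 * - geo n (?w k) + (- 1) ^ k * ?w k ^ n *
        - ((- 1) ^ (2 * N - 1 - k) * (weight N (2 * N - 1 - k) * geo n (inverse (?w (2 * N - 1 - k))))) =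
      ((- 1) ^ k * (- 1) ^ k) * (inverse (weight N k) * ?w k ^ n * geo n (?w k))"
      unfolding rv[OF k] by (simp add: power_inverse)
    then show "0 * - geo n (?w k) + (- 1) ^ k * ?w k ^ n *
        - ((- 1) ^ (2 * N - 1 - k) * (weight N (2 * N - 1 - k) * geo n (inverse (?w (2 * N - 1 - k))))) =
      inverse (?w k) ^ n * geo n (?w k)"
      unfolding minus_one_sq iw by (simp add: power_inverse)
    show "0 * - ((- 1) ^ k * (weight N k * geo n (inverse (?w k)))) +
        (- 1) ^ k * ?w k ^ n * - geo n (?w (2 * N - 1 - k)) = - ((- 1) ^ k * (?w k * geo n (?w k)))"
      unfolding rv[OF k] using geo_inverse[OF w0, of k n] by (simp add: power_inverse)
  qed
  have "torsion_num m n (2 * N) (sym_rep (2 * N) \<circ> \<rho>) = det ?C * det (?A * ?Y - ?B)"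
    unfolding torsion_num_def fox_block_rel1_X1 fox_block_rel1_X2 fox_block_rel2_X1 fox_block_rel2_X2
      CY[symmetric]
    by (rule det_four_block_mat_lower_left_factor[of _ "2 * N"]) simp_all
  \<comment> \<open>In each mirror pair the signs are opposite and the powers of the weights are
    inverse to each other, so every factor is 1.\<close>
  also have "det ?C = 1"
    unfolding det_cross
  proof (rule prod.neutral, rule ballI)
    fix k assume "k \<in> {..<N}"
    then have k: "k < 2 * N" by simp
    have "0 * 0 - (- 1) ^ k * ?w k ^ n * ((- 1) ^ (2 * N - 1 - k) * ?w (2 * N - 1 - k) ^ n) =
        ((- 1) ^ k * (- 1) ^ k) * (?w k ^ n * inverse (?w k ^ n))"
      unfolding rv[OF k] by (simp add: power_inverse)
    then show "0 * 0 - (- 1) ^ k * ?w k ^ n * ((- 1) ^ (2 * N - 1 - k) * ?w (2 * N - 1 - k) ^ n) = 1"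
      unfolding minus_one_sq using w0[of k] by simp
  qed
  also have "?A * ?Y - ?B = cross N
      (\<lambda>k. geo m (weight N k) * geo n (?w k) + geo m (inverse (weight N k)) * geo n (?w k) * inverse (weight N k)
        - inverse (weight N k) ^ m)
      (\<lambda>k. (- 1) ^ k * (geo n (inverse (?w k)) * (geo m (weight N k) * weight N k - geo m (inverse (weight N k)))))"
    (is "_ = cross N ?F ?G")
    unfolding cross_mult cross_minus
  proof (rule cross_cong)
    fix k assume k: "k < 2 * N"
    have "- geo m (weight N k) * - geo n (?w k) + (- 1) ^ k * geo m (inverse (weight N k)) *
        - ((- 1) ^ (2 * N - 1 - k) * (weight N (2 * N - 1 - k) * geo n (inverse (?w (2 * N - 1 - k)))))
        - inverse (weight N k) ^ m =
      geo m (weight N k) * geo n (?w k) + ((- 1) ^ k * (- 1) ^ k) *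
        (geo m (inverse (weight N k)) * geo n (?w k) * inverse (weight N k)) - inverse (weight N k) ^ m"
      unfolding rv[OF k] by (simp add: power_inverse)
    then show "- geo m (weight N k) * - geo n (?w k) + (- 1) ^ k * geo m (inverse (weight N k)) *
        - ((- 1) ^ (2 * N - 1 - k) * (weight N (2 * N - 1 - k) * geo n (inverse (?w (2 * N - 1 - k)))))
        - inverse (weight N k) ^ m = ?F k"
      unfolding minus_one_sq by simp
    show "- geo m (weight N k) * - ((- 1) ^ k * (weight N k * geo n (inverse (?w k)))) +
        (- 1) ^ k * geo m (inverse (weight N k)) * - geo n (?w (2 * N - 1 - k)) - 0 = ?G k"
      unfolding rv[OF k] by (simp add: power_inverse algebra_simps)
  qed
  also have "det (cross N ?F ?G) = (\<Prod>k<N. pairdet m n (weight N k))"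
    unfolding det_cross
  proof (rule prod.cong[OF HOL.refl])
    fix k assume "k \<in> {..<N}"
    then have k: "k < 2 * N" by simp
    let ?r = "2 * N - 1 - k"
    have F: "?F ?r = geo m (inverse (weight N k)) * geo n (inverse (?w k)) +
        geo m (weight N k) * geo n (inverse (?w k)) * weight N k - weight N k ^ m"
      unfolding rv[OF k] by (simp add: power_inverse)
    have G: "?G ?r = - ((- 1) ^ k * (geo n (?w k) *
        (geo m (inverse (weight N k)) * inverse (weight N k) - geo m (weight N k))))"
      unfolding rv[OF k] by (simp add: power_inverse)
    have "?G k * ?G ?r = ((- 1) ^ k * (- 1) ^ k) * ((geo m (weight N k) * weight N k - geo m (inverse (weight N k)))
        * (geo m (weight N k) - geo m (inverse (weight N k)) * inverse (weight N k))
        * geo n (?w k) * geo n (inverse (?w k)))"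
      unfolding G by (simp add: mult_ac) (simp add: algebra_simps)
    then show "?F k * ?F ?r - ?G k * ?G ?r = pairdet m n (weight N k)"
      unfolding F minus_one_sq by (simp add: pairdet_def Let_def)
  qed
  finally show ?thesis by (simp only: mult_1)
qed

text \<open>Each mirror pair contributes the determinant of a 2 x 2 matrix with diagonal -1, -1 and
  opposite signs off the diagonal, which is 2.\<close>

lemma torsion_den_eq: "torsion_den m n (2 * N) (sym_rep (2 * N) \<circ> \<rho>) = 2 ^ N"
proof -
  have one: "\<one>\<^bsub>twist_group m n\<^esub> = word_class (twist_rels m n) []" by (rule word_class_one)
  have "gr_lin_ext (2 * N) (sym_rep (2 * N) \<circ> \<rho>) (Poly_Mapping.single (twist_elt m n Mu) 1
      - Poly_Mapping.single \<one>\<^bsub>twist_group m n\<^esub> 1) = cross N (\<lambda>_. - 1) (\<lambda>k. (- 1) ^ k)"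
    (is "?L = ?R")
  proof (rule eq_matI)
    fix i j assume "i < dim_row ?R" "j < dim_col ?R"
    then have ij: "i < 2 * N" "j < 2 * N" by simp_all
    have "ev [] = dp 0" by (simp add: ev_nil dp_def)
    then have "?L $$ (i, j) = sym_rep (2 * N) (ep 0) $$ (i, j) - sym_rep (2 * N) (dp 0) $$ (i, j)"
      using ij by (simp add: gr_lin_ext_index twist_elt_def one ev_letter)
    then show "?L $$ (i, j) = ?R $$ (i, j)"
      using ij reflect_neq[of i N] by (auto simp: sym_dp sym_ep cross_index)
  qed (simp_all add: gr_lin_ext_def)
  then have "torsion_den m n (2 * N) (sym_rep (2 * N) \<circ> \<rho>) = det (cross N (\<lambda>_. - 1) (\<lambda>k. (- 1) ^ k))"
    by (simp add: torsion_den_def)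
  also have "\<dots> = (\<Prod>k<N. 2)"
    unfolding det_cross
  proof (rule prod.cong[OF HOL.refl])
    fix k assume "k \<in> {..<N}"
    then have k: "k < 2 * N" by simp
    show "- 1 * - 1 - (- 1) ^ k * (- 1) ^ (2 * N - 1 - k) = (2 :: complex)"
      using minus_one_power_reflect[OF k] minus_one_sq(1)[of k] by simp
  qed
  finally show ?thesis by simp
qed

text \<open>The first N weights are \<open>a\<close> to the powers 1 - 2N, ..., -3, -1. In reverse
  order the factor with index \<open>k\<close> no longer depends on \<open>N\<close>, so the
  torsions become partial products of one sequence.\<close>

lemma weight_reindex: "(\<Prod>k<N. f (weight N k)) = (\<Prod>k<N. f (inverse a ^ (2 * k + 1)))"
proof -
  have "(\<Prod>k<N. f (weight N k)) = (\<Prod>k<N. f (weight N (N - Suc k)))"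
    by (rule prod.nat_diff_reindex[symmetric])
  also have "\<dots> = (\<Prod>k<N. f (inverse a ^ (2 * k + 1)))"
  proof (rule prod.cong[OF HOL.refl])
    fix k assume "k \<in> {..<N}"
    then have "2 * int (N - Suc k) - int (2 * N) + 1 = - int (2 * k + 1)" by simp
    then have "weight N (N - Suc k) = inverse a ^ (2 * k + 1)"
      unfolding weight_def by (simp only: power_int_minus power_int_of_nat power_inverse)
    then show "f (weight N (N - Suc k)) = f (inverse a ^ (2 * k + 1))" by simp
  qed
  finally show ?thesis .
qed
end

section \<open>Means of periodic sequences\<close>

text \<open>The partial sums \<open>D\<close> of the deviations from the mean over one period are
  periodic, hence bounded, and vanish after division by N.\<close>

lemma Cesaro_periodic:
  fixes g :: "nat \<Rightarrow> real"
  assumes q: "q > 0" and per: "\<And>j. g (j + q) = g j"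
  shows "(\<lambda>N. (\<Sum>j<N. g j) / real N) \<longlonglongrightarrow> (\<Sum>j<q. g j) / real q"
proof -
  define \<mu> where "\<mu> = (\<Sum>j<q. g j) / real q"
  define D where "D N = (\<Sum>j<N. g j - \<mu>)" for N
  have Dq: "D q = 0" using q by (simp add: D_def sum_subtractf \<mu>_def)
  have Dper: "D (N + q) = D N" for N
  proof (induction N)
    case (Suc N)
    then show ?case using per[of N] by (simp add: D_def)
  qed (use Dq in \<open>simp add: D_def\<close>)
  have Dmod: "D N = D (N mod q)" for N
  proof -
    have "D (r + k * q) = D r" for r k
    proof (induction k)
      case (Suc k)
      then show ?case using Dper[of "r + k * q"] by (simp add: ac_simps)
    qed simp
    from this[of "N mod q" "N div q"] show ?thesis by simp
  qed
  have "Bseq D"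
  proof (rule BseqI')
    fix N
    have "norm (D (N mod q)) \<le> Max (norm ` D ` {..<q})"
      using q by (intro Max_ge) auto
    then show "norm (D N) \<le> Max (norm ` D ` {..<q})" using Dmod[of N] by simp
  qed
  then have "(\<lambda>N. D N * inverse (real N)) \<longlonglongrightarrow> 0"
    using bounded_bilinear.Bfun_prod_Zfun[OF bounded_bilinear_mult, of D sequentially "\<lambda>N. inverse (real N)"]
      lim_inverse_n by (simp add: tendsto_Zfun_iff)
  then have "(\<lambda>N. D N * inverse (real N) + \<mu>) \<longlonglongrightarrow> 0 + \<mu>"
    by (intro tendsto_intros)
  moreover have "eventually (\<lambda>N. D N * inverse (real N) + \<mu> = (\<Sum>j<N. g j) / real N) sequentially"
    using eventually_gt_at_top[of 0]
    by eventually_elim (simp add: D_def sum_subtractf field_simps)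
  ultimately have "(\<lambda>N. (\<Sum>j<N. g j) / real N) \<longlonglongrightarrow> 0 + \<mu>"
    by (rule Lim_transform_eventually)
  then show ?thesis by (simp add: \<mu>_def)
qed

text \<open>An affine map with slope prime to q permutes the residues mod q.\<close>

lemma sum_periodic_affine:
  fixes f :: "nat \<Rightarrow> 'a::comm_monoid_add"
  assumes per: "\<And>j. f (j + q) = f j" and co: "coprime \<alpha> q"
  shows "(\<Sum>j<q. f (\<alpha> * j + \<beta>)) = (\<Sum>j<q. f j)"
proof (cases "q = 0")
  case False
  have mod: "f N = f (N mod q)" for N
  proof -
    have "f (r + k * q) = f r" for r k
    proof (induction k)
      case (Suc k)
      then show ?case using per[of "r + k * q"] by (simp add: ac_simps)
    qed simp
    from this[of "N mod q" "N div q"] show ?thesis by simp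
  qed
  define p where "p j = (\<alpha> * j + \<beta>) mod q" for j
  have inj: "inj_on p {..<q}"
  proof (rule inj_onI)
    fix x y assume xy: "x \<in> {..<q}" "y \<in> {..<q}" "p x = p y"
    then have "[\<alpha> * x + \<beta> = \<alpha> * y + \<beta>] (mod q)" by (simp add: p_def cong_def)
    then have "[x = y] (mod q)"
      using co by (simp add: cong_add_rcancel_nat cong_mult_lcancel_nat)
    then show "x = y" using xy by (simp add: cong_def)
  qed
  have "p ` {..<q} \<subseteq> {..<q}" using False by (auto simp: p_def)
  then have "p ` {..<q} = {..<q}" using inj by (intro endo_inj_surj) auto
  then have "(\<Sum>j<q. f j) = (\<Sum>j<q. f (p j))"
    using sum.reindex[OF inj, of f] by simp
  then show ?thesis using mod by (simp add: p_def)
qed simp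

section \<open>Absolute values on the unit circle and their logarithmic mean\<close>

lemma norm_inverse_minus_1: "norm z = 1 \<Longrightarrow> norm (inverse z - 1) = norm (z - 1 :: complex)"
proof -
  assume z: "norm z = 1"
  then have "inverse z - 1 = (1 - z) / z" by (cases "z = 0") (auto simp: field_simps)
  then show ?thesis using z by (simp add: norm_divide norm_minus_commute)
qed

text \<open>For |z| = 1 the factors s, s' of \<open>pairdet_factor\<close> have equal modulus, and
  so have t, t'; this produces the squares. No denominator vanishes: U^2 = z gives U \<noteq> 1, and
  U = (z^(2m))^n then gives z^(2m) \<noteq> 1.\<close>

lemma norm_pairdet:
  fixes z :: complex
  assumes z: "norm z = 1" "z ^ (4 * m * n) = z" "z \<noteq> 1"
  shows "z ^ m \<noteq> 1" "z ^ (2 * m) \<noteq> 1" "z ^ (2 * m * n) \<noteq> 1"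
    and "norm (pairdet m n z) = 4 * (norm (z ^ m - 1) / norm (z - 1))\<^sup>2 *
      (norm (z ^ (2 * m * n) - 1) / norm (z ^ (2 * m) - 1))\<^sup>2"
proof -
  have z0: "z \<noteq> 0" using z(1) by auto
  define Z U where "Z = z ^ m" and "U = z ^ (2 * m * n)"
  have Z2: "z ^ (2 * m) = Z\<^sup>2" and U: "Z\<^sup>2 ^ n = U" and zU: "z = U\<^sup>2"
    using z(2) by (simp_all add: Z_def U_def power_mult[symmetric] mult_ac)
  have norm: "norm Z = 1" "norm U = 1" "norm (Z\<^sup>2) = 1" by (simp_all add: Z_def U_def norm_power z(1))
  have U2: "U\<^sup>2 \<noteq> 1" using z(3) zU by simp
  then show U1: "z ^ (2 * m * n) \<noteq> 1" unfolding U_def[symmetric] by auto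
  then have Zn: "Z\<^sup>2 \<noteq> 1" using U unfolding U_def by (metis power_one)
  then show "z ^ m \<noteq> 1" "z ^ (2 * m) \<noteq> 1" unfolding Z2 by (auto simp: Z_def)
  have inv: "inverse z \<noteq> 1" "inverse (Z\<^sup>2) \<noteq> 1" using z(3) Zn by (simp_all add: inverse_eq_1_iff)
  define s s' t t' where "s = (Z - 1) / (U\<^sup>2 - 1)" "s' = (inverse Z - 1) / (inverse (U\<^sup>2) - 1)"
    "t = (U - 1) / (Z\<^sup>2 - 1)" "t' = (inverse U - 1) / (inverse (Z\<^sup>2) - 1)"
  have "pairdet m n z = (s * t + s' * t * inverse z - inverse Z) * (s' * t' + s * t' * z - Z)
      - (s * z - s') * (s - s' * inverse z) * t * t'"
  proof -
    have "(\<Sum>l<m. z ^ l) = s" "(\<Sum>l<m. inverse z ^ l) = s'"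
      "(\<Sum>l<n. (Z\<^sup>2) ^ l) = t" "(\<Sum>l<n. inverse (Z\<^sup>2) ^ l) = t'"
      unfolding geometric_sum[OF z(3)] geometric_sum[OF inv(1)] geometric_sum[OF Zn]
        geometric_sum[OF inv(2)] s_s'_t_t'_def U zU[symmetric] by (simp_all add: Z_def power_inverse U[symmetric])
    then show ?thesis
      unfolding pairdet_def Let_def Z2 by (simp add: Z_def[symmetric] power_inverse)
  qed
  also have "\<dots> = 4 * s * s' * t * t'"
    using z0 norm U2 Zn by (intro pairdet_factor[OF _ _ U2 Zn zU s_s'_t_t'_def]) auto
  finally have P: "norm (pairdet m n z) = 4 * norm s * norm s' * norm t * norm t'"
    by (simp add: norm_mult)
  have N: "norm s = norm (Z - 1) / norm (z - 1)" "norm s' = norm (Z - 1) / norm (z - 1)"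
    "norm t = norm (U - 1) / norm (Z\<^sup>2 - 1)" "norm t' = norm (U - 1) / norm (Z\<^sup>2 - 1)"
    unfolding s_s'_t_t'_def zU[symmetric]
    using norm z(1) by (simp_all add: norm_divide norm_inverse_minus_1)
  show "norm (pairdet m n z) = 4 * (norm (z ^ m - 1) / norm (z - 1))\<^sup>2 *
      (norm (z ^ (2 * m * n) - 1) / norm (z ^ (2 * m) - 1))\<^sup>2"
    unfolding P N Z2 Z_def[symmetric] U_def[symmetric] by (simp add: power2_eq_square)
qed

text \<open>The division by 2 is the share of each factor in the denominator 2^N of the torsion, and
  the odd exponents are those of \<open>weight_reindex\<close>.\<close>

lemma mean_ln_norm_pairdet:
  fixes c :: complex
  assumes mn: "m \<ge> 1" "n \<ge> 1" and c: "norm c = 1" "c ^ (4 * m * n) = c" and q: "q > 0"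
    "\<And>k. c ^ k = 1 \<longleftrightarrow> q dvd k"
    and co: "coprime 2 q" "coprime m q" "coprime n q"
  shows "pairdet m n (c ^ k) \<noteq> 0"
    and "(\<lambda>N. (\<Sum>k<N. ln (norm (pairdet m n (c ^ (2 * k + 1))) / 2)) / real N) \<longlonglongrightarrow>
      ln 2 + 2 / real q * ln ((2 * real m * real n - 1) / 2)"
proof -
  define L where "L = ln ((2 * real m * real n - 1) / 2)"
  have "1 \<le> m * n" using mn by simp
  then have "1 \<le> real (m * n)" by (metis of_nat_1 of_nat_le_iff)
  then have mn1: "2 * real m * real n - 1 > 0" by (simp add: mult.assoc)
  have pow: "(c ^ k) ^ p = c ^ (p * k)" for k p by (simp add: power_mult[symmetric] mult.commute)
  define h where "h r = ln (norm (c ^ r - 1))" for r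
  define \<delta> where "\<delta> k = (if q dvd k then 1 else 0 :: real)" for k
  define G where "G k = ln (norm (pairdet m n (c ^ k)) / 2)" for k
  \<comment> \<open>As \<open>ln 0 = 0\<close>, the formula \<open>G\<close> below also holds for multiples of \<open>q\<close>.\<close>
  have h0: "h r = 0" if "c ^ r = 1" for r using that by (simp add: h_def)
  have cn: "norm (c ^ k) = 1" "(c ^ k) ^ (4 * m * n) = c ^ k" for k
    using c by (simp_all add: norm_power) (metis power_commutes power_mult mult.commute)
  have p1: "norm (pairdet m n 1) = (2 * real m * real n - 1)\<^sup>2"
  proof -
    have "pairdet m n 1 = of_real ((2 * real m * real n - 1)\<^sup>2)" by (simp add: pairdet_1)
    then show ?thesis by (simp only: norm_of_real) simp
  qed
  show "pairdet m n (c ^ k) \<noteq> 0" for k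
  proof (cases "c ^ k = 1")
    case True
    then show ?thesis using p1 mn1 by force
  next
    case False
    then show ?thesis
      using norm_pairdet[OF cn False] by (metis divide_eq_0_iff eq_iff_diff_eq_0 mult_eq_0_iff norm_eq_zero power_eq_0_iff zero_neq_numeral)
  qed
  have G: "G k = ln 2 + 2 * (h (m * k) - h k) + 2 * (h (2 * m * n * k) - h (2 * m * k)) + \<delta> k * (2 * L)"
    for k
  proof (cases "c ^ k = 1")
    case True
    then have "c ^ (p * k) = 1" for p by (metis power_mult mult.commute power_one)
    then have "h (p * k) = 0" "h k = 0" for p using True by (simp_all add: h0)
    moreover have "\<delta> k = 1" using True q(2) by (simp add: \<delta>_def)
    \<comment> \<open>With M = 2mn - 1, ln (M^2 / 2) = ln 2 + 2 ln (M / 2): the excess over the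
      generic constant ln 2 is \<open>2 * L\<close>.\<close>
    moreover have "G k = ln 2 + 2 * L"
      using mn1 unfolding G_def True p1 L_def by (simp add: ln_div ln_mult ln_realpow)
    ultimately show ?thesis by simp
  next
    case False
    have "\<delta> k = 0" using False q(2) by (simp add: \<delta>_def)
    moreover have "G k = ln (2 * (norm (c ^ (m * k) - 1) / norm (c ^ k - 1))\<^sup>2 *
      (norm (c ^ (2 * m * n * k) - 1) / norm (c ^ (2 * m * k) - 1))\<^sup>2)"
      unfolding G_def norm_pairdet(4)[OF cn False] pow by (simp add: mult.assoc)
    moreover have "c ^ (m * k) \<noteq> 1" "c ^ (2 * m * n * k) \<noteq> 1" "c ^ (2 * m * k) \<noteq> 1"
      using norm_pairdet(1-3)[OF cn False] unfolding pow by auto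
    ultimately show ?thesis
      using False by (simp add: ln_mult ln_div ln_realpow h_def power_divide)
  qed
  have per: "c ^ (k + q) = c ^ k" for k using q(2)[of q] by (simp add: power_add)
  \<comment> \<open>Makes the differences of \<open>h\<close> in \<open>G\<close> cancel over a
    period, with p = m, 2mn and 2m.\<close>
  have hs: "(\<Sum>k<q. h (p * k)) = (\<Sum>k<q. h k)" if "coprime p q" for p
    using sum_periodic_affine[of h q p 0] that per by (simp add: h_def)
  \<comment> \<open>As q is odd, the exponents 2k + 1 meet every residue mod q once.\<close>
  have "(\<Sum>k<q. G (2 * k + 1)) = (\<Sum>k<q. G k)"
    by (rule sum_periodic_affine) (use co per in \<open>simp_all add: G_def\<close>)
  also have "\<dots> = real q * ln 2 + (\<Sum>k<q. \<delta> k) * (2 * L)"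
    using co by (simp add: G sum.distrib sum_subtractf sum_distrib_left[symmetric]
        sum_distrib_right[symmetric] hs)
  also have "(\<Sum>k<q. \<delta> k) = (\<Sum>k\<in>{0}. \<delta> k)"
    by (rule sum.mono_neutral_right) (use q in \<open>auto simp: \<delta>_def dest: dvd_imp_le\<close>)
  finally have S: "(\<Sum>k<q. G (2 * k + 1)) / real q = ln 2 + 2 / real q * L"
    using q(1) by (simp add: \<delta>_def field_simps)
  have "(\<lambda>N. (\<Sum>k<N. G (2 * k + 1)) / real N) \<longlonglongrightarrow> (\<Sum>k<q. G (2 * k + 1)) / real q"
  proof (rule Cesaro_periodic[OF q(1)])
    fix j
    have "2 * (j + q) + 1 = 2 * j + 1 + q + q" by simp
    then show "G (2 * (j + q) + 1) = G (2 * j + 1)" unfolding G_def by (simp only: per)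
  qed
  then show "(\<lambda>N. (\<Sum>k<N. ln (norm (pairdet m n (c ^ (2 * k + 1))) / 2)) / real N) \<longlonglongrightarrow>
      ln 2 + 2 / real q * ln ((2 * real m * real n - 1) / 2)"
    unfolding S unfolding G_def L_def .
qed

text \<open>The power is 1 exactly when Q divides i k; after division by the gcd, the cofactor of i
  is prime to that of Q and can be cancelled.\<close>

lemma cis_root_power_eq_1_iff:
  fixes Q i k :: nat
  assumes "Q > 0"
  shows "cis (2 * pi / real Q) ^ (i * k) = 1 \<longleftrightarrow> Q div gcd Q i dvd k"
proof -
  have "cis (2 * pi / real Q) ^ j = 1 \<longleftrightarrow> Q dvd j" for j
  proof
    assume "cis (2 * pi / real Q) ^ j = 1"
    then have "cos (real j * (2 * pi / real Q)) = 1"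
      by (simp add: DeMoivre complex_eq_iff)
    then obtain p :: int where "real j * (2 * pi / real Q) = real_of_int p * 2 * pi"
      unfolding cos_one_2pi_int by blast
    then have "real j = real_of_int p * real Q"
      using assms by (simp add: field_simps)
    then have "int j = p * int Q"
      by (metis of_int_eq_iff of_int_mult of_int_of_nat_eq)
    then show "Q dvd j" by (metis dvd_triv_right int_dvd_int_iff)
  next
    assume "Q dvd j"
    then obtain p where "j = Q * p" by blast
    moreover have "cis (2 * pi / real Q) ^ Q = 1" using assms by (simp add: DeMoivre)
    ultimately show "cis (2 * pi / real Q) ^ j = 1" by (simp add: power_mult)
  qed
  moreover have "Q dvd i * k \<longleftrightarrow> Q div gcd Q i dvd k"
  proof -
    define g where "g = gcd Q i"
    have g: "g > 0" "Q = g * (Q div g)" "i = g * (i div g)" using assms by (simp_all add: g_def)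
    have "coprime (Q div g) (i div g)"
      unfolding g_def by (rule div_gcd_coprime) (use assms in simp)
    moreover have "Q dvd i * k \<longleftrightarrow> g * (Q div g) dvd g * (i div g * k)"
      using g(2,3) by (simp add: mult.assoc[symmetric])
    ultimately show ?thesis
      using g(1) unfolding g_def[symmetric] by (simp add: coprime_dvd_mult_right_iff)
  qed
  ultimately show ?thesis by simp
qed

theorem corollary4p5:
  fixes m n i q :: nat
    and \<xi> :: complex
    and \<rho> :: "knot_gen word set \<Rightarrow> complex mat"
    and T :: "nat \<Rightarrow> complex"
  assumes "m \<ge> 1" and "n \<ge> 1"
    and "1 \<le> i" and "i \<le> 2 * m * n - 1"
    and "\<xi> = exp (2 * of_real pi * \<i> / (4 * of_nat m * of_nat n - 1))"
    and "\<rho> \<in> hom (twist_group m n) (SL 2)"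
    and "irreducible_rep (twist_group m n) 2 \<rho>"
    and "metabelian_rep (twist_group m n) \<rho>"
    and "\<rho> (twist_elt m n X1) = mat_of_rows_list 2 [[\<xi> ^ i, 0], [0, inverse (\<xi> ^ i)]]"
    and "\<rho> (twist_elt m n X2) =
           mat_of_rows_list 2 [[\<xi> ^ (2 * m * i), 0], [0, inverse (\<xi> ^ (2 * m * i))]]"
    and "\<rho> (twist_elt m n Mu) = mat_of_rows_list 2 [[0, 1], [-1, 0]]"
    and "q = (4 * m * n - 1) div gcd (4 * m * n - 1) i"
    and "\<And>N. T N = torsion m n (2 * N) (sym_rep (2 * N) \<circ> \<rho>)"
  shows "(\<forall>N\<ge>1. torsion_defined m n (2 * N) (sym_rep (2 * N) \<circ> \<rho>)) \<and>
    (\<lambda>N. ln (cmod (T N)) / (2 * real N)) \<longlonglongrightarrow>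
      1 / real q * ln ((2 * real m * real n - 1) / 2) + 1 / 2 * ln 2 \<and>
    1 / real q * ln ((2 * real m * real n - 1) / 2) + 1 / 2 * ln 2 =
      real (gcd (4 * m * n - 1) i) / (4 * real m * real n - 1) * ln ((2 * real m * real n - 1) / 2)
        + 1 / 2 * ln 2 \<and>
    convergent (\<lambda>N. ln (cmod (T N)) / (2 * real N))"
proof -
  define Q where "Q = 4 * m * n - 1"
  \<comment> \<open>The inverse is the base of the powers because the first half of the weights has
    negative exponents.\<close>
  define a c where "a = \<xi> ^ i" and "c = inverse a"
  have "m * n > 0" using assms(1,2) by simp
  then have Q: "4 * m * n = Suc Q" "Q > 0"
    unfolding Q_def mult.assoc by linarith+
  have rQ: "4 * real m * real n - 1 = real Q"
    using arg_cong[OF Q(1), of real] by simp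
  have \<xi>: "\<xi> = cis (2 * pi / real Q)"
  proof -
    have "(4 * of_nat m * of_nat n - 1 :: complex) = of_real (real Q)"
      unfolding rQ[symmetric] by simp
    then show ?thesis unfolding assms(5) cis_conv_exp by (simp add: mult_ac)
  qed
  have q: "q = Q div gcd Q i" by (simp add: assms(12) Q_def)
  have a1: "a ^ k = 1 \<longleftrightarrow> q dvd k" for k
    using cis_root_power_eq_1_iff[OF Q(2), of i k] by (simp add: a_def \<xi> q power_mult)
  have qQ: "q dvd Q" unfolding q by (metis dvd_div_mult_self dvd_triv_left gcd_dvd1)
  have q0: "q > 0" using qQ Q(2) by (rule dvd_pos_nat[rotated])
  have na: "norm a = 1" by (simp add: a_def \<xi> norm_power)
  then have a0: "a \<noteq> 0" by auto
  have apow: "a ^ (4 * m * n) = a" using a1[of Q] qQ by (simp add: Q(1))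
  have c1: "c ^ k = 1 \<longleftrightarrow> q dvd k" for k
    using a1[of k] by (simp add: c_def power_inverse inverse_eq_1_iff)
  have c: "norm c = 1" "c ^ (4 * m * n) = c"
    using na apow by (simp_all add: c_def norm_inverse power_inverse)
  \<comment> \<open>Divisors of 4mn = Q + 1 are prime to Q, hence to its divisor q.\<close>
  have co: "coprime p q" if "p dvd 4 * m * n" for p
  proof -
    have "coprime (Suc Q) Q" by (rule coprime_Suc_left_nat)
    then show ?thesis using that qQ unfolding Q(1) by (rule coprime_divisors[rotated 2])
  qed
  interpret monomial_rep m n a \<rho>
  proof
    show "\<rho> (twist_elt m n X2) = dmat (a ^ (2 * m))"
      using assms(10) by (simp add: dmat_def a_def power_mult[symmetric] mult.commute)
  qed (use assms a0 apow in \<open>simp_all add: dmat_def emat_def a_def\<close>)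
  note S = mean_ln_norm_pairdet[OF assms(1,2) c q0 c1 co co co]
  have d: "2 dvd 4 * m * n" "m dvd 4 * m * n" "n dvd 4 * m * n" by simp_all
  have nz: "pairdet m n (c * c ^ (2 * k)) \<noteq> 0" for k
    using S(1)[OF d, of "2 * k + 1"] by simp
  have T: "torsion_defined m n (2 * N) (sym_rep (2 * N) \<circ> \<rho>)"
    "T N = (\<Prod>k<N. pairdet m n (c ^ (2 * k + 1)) / 2)" for N
    unfolding assms(13) torsion_defined_def torsion_def torsion_num_eq torsion_den_eq
      weight_reindex[of "pairdet m n"] c_def[symmetric]
    using nz by (simp_all add: prod_dividef)
  \<comment> \<open>There are N factors, one for each mirror pair, but the normalization is 2N; the
    extra 1/2 turns ln 2 and 2/q into (ln 2)/2 and 1/q.\<close>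
  have mean: "ln (cmod (T N)) / (2 * real N) =
      (\<Sum>k<N. ln (norm (pairdet m n (c ^ (2 * k + 1))) / 2)) / real N / 2" for N
  proof -
    have "ln (cmod (T N)) = (\<Sum>k<N. ln (norm (pairdet m n (c ^ (2 * k + 1)) / 2)))"
      unfolding T(2) prod_norm[symmetric] using nz by (intro ln_prod) auto
    then show ?thesis by (simp add: norm_divide)
  qed
  have "(\<lambda>N. ln (cmod (T N)) / (2 * real N)) \<longlonglongrightarrow>
      (ln 2 + 2 / real q * ln ((2 * real m * real n - 1) / 2)) / 2"
    unfolding mean by (intro tendsto_divide S(2)[OF d] tendsto_const) simp
  then have lim: "(\<lambda>N. ln (cmod (T N)) / (2 * real N)) \<longlonglongrightarrow>
      1 / real q * ln ((2 * real m * real n - 1) / 2) + 1 / 2 * ln 2"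
    by (simp add: add_divide_distrib add.commute)
  have "real q * real (gcd Q i) = real Q"
    unfolding q of_nat_mult[symmetric] by simp
  then have "1 / real q = real (gcd (4 * m * n - 1) i) / (4 * real m * real n - 1)"
    unfolding rQ Q_def[symmetric] using q0 Q(2) by (simp add: field_simps)
  with lim T(1) show ?thesis by (simp add: convergent_def) blast
qed

end
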